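(* Let $k$ be a countable field and $\mathcal{D}$ a countable set. Every countably generated associative differential algebra $A$ over $k$ with differential operations $\mathcal{D}$ (with $1\neq 0$ in $A$) can be embedded into a simple two-generated associative differential algebra over $k$ with differential operations $\mathcal{D}$; that is, there exist a simple $\mathcal{D}$-algebra $\mathcal{A}$ generated as a $\mathcal{D}$-algebra by two elements and an injective homomorphism of $\mathcal{D}$-algebras $A\to\mathcal{A}$.
   Context: An associative differential algebra with differential operations $\mathcal{D}$ (a $\mathcal{D}$-algebra) over a field $k$ is an associative unital $k$-algebra $A$ together with, for each $D\in\mathcal{D}$, a $k$-linear map $D:A\to A$ satisfying $D(ab)=D(a)b+aD(b)$ for all $a,b\in A$. The operations in $\mathcal{D}$ are not assumed to commute with one another. Homomorphisms of $\mathcal{D}$-algebras are unital $k$-algebra homomorphisms commuting with every $D\in\mathcal{D}$. A $\mathcal{D}$-algebra is generated by a subset $Y$ if the smallest unital $k$-subalgebra containing $Y$ and closed under all $D\in\mathcal{D}$ is the whole algebra; it is countably generated if it is generated by an at most countable set. A $\mathcal{D}$-algebra is simple if it is nonzero and its only two-sided ideals closed under all $D\in\mathcal{D}$ are $0$ and itself. "Countable" means at most countable. *)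

theory Defs
  imports "HOL-Algebra.Module" "HOL-Algebra.Ideal" "HOL-Algebra.Subrings"
    "HOL-Library.Countable_Set"
begin

text \<open>
  The library locale \<^locale>\<open>algebra\<close> requires the algebra to be commutative, hence the
  following variant for associative unital algebras over a field.
\<close>

locale associative_algebra =
  R?: field R + M?: module R M + M?: ring M
  for R (structure) and M (structure) +
  assumes smult_mult_left:
    "\<lbrakk>c \<in> carrier R; x \<in> carrier M; y \<in> carrier M\<rbrakk> \<Longrightarrow>
       (c \<odot>\<^bsub>M\<^esub> x) \<otimes>\<^bsub>M\<^esub> y = c \<odot>\<^bsub>M\<^esub> (x \<otimes>\<^bsub>M\<^esub> y)"
    and smult_mult_right:
    "\<lbrakk>c \<in> carrier R; x \<in> carrier M; y \<in> carrier M\<rbrakk> \<Longrightarrow>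
       x \<otimes>\<^bsub>M\<^esub> (c \<odot>\<^bsub>M\<^esub> y) = c \<odot>\<^bsub>M\<^esub> (x \<otimes>\<^bsub>M\<^esub> y)"

text \<open>
  The operations are indexed by elements of a set \<open>\<D> :: 'd set\<close>; \<open>der A d\<close> is the operation of
  \<open>A\<close> with index \<open>d\<close>. Values of \<open>der\<close> at indices outside \<open>\<D>\<close> are irrelevant.
\<close>

record ('k, 'a, 'd) diff_algebra = "('k, 'a) module" +
  der :: "'d \<Rightarrow> 'a \<Rightarrow> 'a"

locale differential_algebra =
  associative_algebra K A
  for K (structure) and \<D> :: "'d set" and A :: "('k, 'a, 'd) diff_algebra" (structure) +
  assumes der_closed:
    "\<lbrakk>d \<in> \<D>; x \<in> carrier A\<rbrakk> \<Longrightarrow> der A d x \<in> carrier A"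
    and der_add:
    "\<lbrakk>d \<in> \<D>; x \<in> carrier A; y \<in> carrier A\<rbrakk> \<Longrightarrow>
       der A d (x \<oplus>\<^bsub>A\<^esub> y) = der A d x \<oplus>\<^bsub>A\<^esub> der A d y"
    and der_smult:
    "\<lbrakk>d \<in> \<D>; c \<in> carrier K; x \<in> carrier A\<rbrakk> \<Longrightarrow>
       der A d (c \<odot>\<^bsub>A\<^esub> x) = c \<odot>\<^bsub>A\<^esub> der A d x"
    and der_mult:
    "\<lbrakk>d \<in> \<D>; x \<in> carrier A; y \<in> carrier A\<rbrakk> \<Longrightarrow>
       der A d (x \<otimes>\<^bsub>A\<^esub> y) = (der A d x \<otimes>\<^bsub>A\<^esub> y) \<oplus>\<^bsub>A\<^esub> (x \<otimes>\<^bsub>A\<^esub> der A d y)"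

definition differential_hom ::
    "('k, 'm) ring_scheme \<Rightarrow> 'd set \<Rightarrow> ('k, 'a, 'd) diff_algebra \<Rightarrow>
     ('k, 'b, 'd) diff_algebra \<Rightarrow> ('a \<Rightarrow> 'b) set" where
  "differential_hom K \<D> A B =
     {h \<in> ring_hom A B.
        (\<forall>c \<in> carrier K. \<forall>x \<in> carrier A. h (c \<odot>\<^bsub>A\<^esub> x) = c \<odot>\<^bsub>B\<^esub> h x) \<and>
        (\<forall>d \<in> \<D>. \<forall>x \<in> carrier A. h (der A d x) = der B d (h x))}"

definition differential_subalgebra ::
    "('k, 'm) ring_scheme \<Rightarrow> 'd set \<Rightarrow> ('k, 'a, 'd) diff_algebra \<Rightarrow> 'a set \<Rightarrow> bool" where
  "differential_subalgebra K \<D> A S \<longleftrightarrow>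
     subring S A \<and>
     (\<forall>c \<in> carrier K. \<forall>x \<in> S. c \<odot>\<^bsub>A\<^esub> x \<in> S) \<and>
     (\<forall>d \<in> \<D>. \<forall>x \<in> S. der A d x \<in> S)"

definition differential_generated_by ::
    "('k, 'm) ring_scheme \<Rightarrow> 'd set \<Rightarrow> ('k, 'a, 'd) diff_algebra \<Rightarrow> 'a set \<Rightarrow> bool" where
  "differential_generated_by K \<D> A Y \<longleftrightarrow>
     Y \<subseteq> carrier A \<and>
     \<Inter>{S. differential_subalgebra K \<D> A S \<and> Y \<subseteq> S} = carrier A"

definition countably_generated ::
    "('k, 'm) ring_scheme \<Rightarrow> 'd set \<Rightarrow> ('k, 'a, 'd) diff_algebra \<Rightarrow> bool" where
  "countably_generated K \<D> A \<longleftrightarrow>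
     (\<exists>Y. countable Y \<and> differential_generated_by K \<D> A Y)"

definition two_generated ::
    "('k, 'm) ring_scheme \<Rightarrow> 'd set \<Rightarrow> ('k, 'a, 'd) diff_algebra \<Rightarrow> bool" where
  "two_generated K \<D> A \<longleftrightarrow> (\<exists>a b. differential_generated_by K \<D> A {a, b})"

definition simple_differential_algebra ::
    "'d set \<Rightarrow> ('k, 'a, 'd) diff_algebra \<Rightarrow> bool" where
  \<comment> \<open>ideals are automatically \<open>k\<close>-subspaces, as the algebras are unital\<close>
  "simple_differential_algebra \<D> A \<longleftrightarrow>
     carrier A \<noteq> {\<zero>\<^bsub>A\<^esub>} \<and>
     (\<forall>I. ideal I A \<and> (\<forall>d \<in> \<D>. \<forall>x \<in> I. der A d x \<in> I) \<longrightarrow>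
        I = {\<zero>\<^bsub>A\<^esub>} \<or> I = carrier A)"

text \<open>
  The target algebra of the embedding theorem lives on a subset of \<^typ>\<open>nat\<close>. This is no
  restriction: a countably generated differential algebra over a countable field with countably
  many operations is countable, so it has an isomorphic copy of this form.
\<close>

end

theory Submission
  imports Defs
begin

text \<open>
  Let \<open>V\<close> be the direct sum of countably many copies of \<open>A\<close>. Left multiplication embeds \<open>A\<close> into the
  endomorphisms of \<open>V\<close>, and there every derivation \<open>d\<close> becomes inner: it is the commutator with
  \<open>d\<close> acting coordinatewise. Since \<open>V\<close> has infinitely many copies of \<open>A\<close>, every nonzero \<open>x\<close> of \<open>A\<close>
  satisfies \<open>u x v = 1\<close> for suitable endomorphisms \<open>u\<close>, \<open>v\<close> of \<open>V\<close>. All these endomorphisms are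
  countably many, hence they lie in a subalgebra \<open>C\<close> generated by two endomorphisms. A maximal
  differential ideal of \<open>C\<close> meets \<open>A\<close> trivially, because a nonzero \<open>x\<close> in it would yield
  \<open>1 = u x v\<close>; so \<open>A\<close> embeds into the simple quotient of \<open>C\<close>.
\<close>

text \<open>Endomorphisms are linear over \<open>k\<close> only. Coordinatewise derivations are not
  \<open>A\<close>-linear, and the functional that reads off multiples of \<open>x\<close> exists
  because \<open>k\<close> is a field. One copy of \<open>A\<close> would be too small:
  \<open>u x v = 1\<close> forces the image of left multiplication by \<open>x\<close> to have at
  least the dimension of the whole space, and on \<open>A\<close> itself that can fail. On
  \<open>V\<close> the image contains \<open>x\<close> in each of infinitely many components, which
  is room for a copy of all of \<open>V\<close>, since \<open>A\<close> has countable dimension.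
  Zorn's lemma gives no control over the maximal ideal. None is needed, because an equation
  \<open>u x v = 1\<close> survives in every quotient. Countability enters three times:
  \<open>A\<close> is spanned by a family indexed by \<open>nat\<close>, the required endomorphisms
  form a sequence, and \<open>C\<close> is countable, so that its quotient can live on
  \<open>nat\<close>. The two generators reach every member of the sequence by composition
  alone.\<close>

section \<open>Images, subalgebras and generators\<close>

text \<open>The locale hierarchy is flattened once, so that images, subalgebras and endomorphism
  algebras are checked against one list of elementary laws. Negatives enter only through the
  existence of a left inverse, because negation of a ring record is defined from its other
  fields.\<close>

lemma differential_algebraI:
  fixes K :: "('k, 'm) ring_scheme" and B :: "('k, 'b, 'd) diff_algebra"
  assumes "field K"
    and zero: "\<zero>\<^bsub>B\<^esub> \<in> carrier B" and one: "\<one>\<^bsub>B\<^esub> \<in> carrier B"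
    and add: "\<And>x y. x \<in> carrier B \<Longrightarrow> y \<in> carrier B \<Longrightarrow> x \<oplus>\<^bsub>B\<^esub> y \<in> carrier B"
    and mult: "\<And>x y. x \<in> carrier B \<Longrightarrow> y \<in> carrier B \<Longrightarrow> x \<otimes>\<^bsub>B\<^esub> y \<in> carrier B"
    and smult: "\<And>c x. c \<in> carrier K \<Longrightarrow> x \<in> carrier B \<Longrightarrow> c \<odot>\<^bsub>B\<^esub> x \<in> carrier B"
    and der: "\<And>d x. d \<in> \<D> \<Longrightarrow> x \<in> carrier B \<Longrightarrow> der B d x \<in> carrier B"
    and add_assoc: "\<And>x y z. x \<in> carrier B \<Longrightarrow> y \<in> carrier B \<Longrightarrow> z \<in> carrier B \<Longrightarrow>
      (x \<oplus>\<^bsub>B\<^esub> y) \<oplus>\<^bsub>B\<^esub> z = x \<oplus>\<^bsub>B\<^esub> (y \<oplus>\<^bsub>B\<^esub> z)"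
    and add_comm: "\<And>x y. x \<in> carrier B \<Longrightarrow> y \<in> carrier B \<Longrightarrow> x \<oplus>\<^bsub>B\<^esub> y = y \<oplus>\<^bsub>B\<^esub> x"
    and l_zero: "\<And>x. x \<in> carrier B \<Longrightarrow> \<zero>\<^bsub>B\<^esub> \<oplus>\<^bsub>B\<^esub> x = x"
    and l_neg: "\<And>x. x \<in> carrier B \<Longrightarrow> \<exists>y \<in> carrier B. y \<oplus>\<^bsub>B\<^esub> x = \<zero>\<^bsub>B\<^esub>"
    and mult_assoc: "\<And>x y z. x \<in> carrier B \<Longrightarrow> y \<in> carrier B \<Longrightarrow> z \<in> carrier B \<Longrightarrow>
      (x \<otimes>\<^bsub>B\<^esub> y) \<otimes>\<^bsub>B\<^esub> z = x \<otimes>\<^bsub>B\<^esub> (y \<otimes>\<^bsub>B\<^esub> z)"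
    and l_one: "\<And>x. x \<in> carrier B \<Longrightarrow> \<one>\<^bsub>B\<^esub> \<otimes>\<^bsub>B\<^esub> x = x"
    and r_one: "\<And>x. x \<in> carrier B \<Longrightarrow> x \<otimes>\<^bsub>B\<^esub> \<one>\<^bsub>B\<^esub> = x"
    and l_distr: "\<And>x y z. x \<in> carrier B \<Longrightarrow> y \<in> carrier B \<Longrightarrow> z \<in> carrier B \<Longrightarrow>
      (x \<oplus>\<^bsub>B\<^esub> y) \<otimes>\<^bsub>B\<^esub> z = (x \<otimes>\<^bsub>B\<^esub> z) \<oplus>\<^bsub>B\<^esub> (y \<otimes>\<^bsub>B\<^esub> z)"
    and r_distr: "\<And>x y z. x \<in> carrier B \<Longrightarrow> y \<in> carrier B \<Longrightarrow> z \<in> carrier B \<Longrightarrow>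
      z \<otimes>\<^bsub>B\<^esub> (x \<oplus>\<^bsub>B\<^esub> y) = (z \<otimes>\<^bsub>B\<^esub> x) \<oplus>\<^bsub>B\<^esub> (z \<otimes>\<^bsub>B\<^esub> y)"
    and smult_l: "\<And>a b x. a \<in> carrier K \<Longrightarrow> b \<in> carrier K \<Longrightarrow> x \<in> carrier B \<Longrightarrow>
      (a \<oplus>\<^bsub>K\<^esub> b) \<odot>\<^bsub>B\<^esub> x = (a \<odot>\<^bsub>B\<^esub> x) \<oplus>\<^bsub>B\<^esub> (b \<odot>\<^bsub>B\<^esub> x)"
    and smult_r: "\<And>a x y. a \<in> carrier K \<Longrightarrow> x \<in> carrier B \<Longrightarrow> y \<in> carrier B \<Longrightarrow>
      a \<odot>\<^bsub>B\<^esub> (x \<oplus>\<^bsub>B\<^esub> y) = (a \<odot>\<^bsub>B\<^esub> x) \<oplus>\<^bsub>B\<^esub> (a \<odot>\<^bsub>B\<^esub> y)"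
    and smult_assoc: "\<And>a b x. a \<in> carrier K \<Longrightarrow> b \<in> carrier K \<Longrightarrow> x \<in> carrier B \<Longrightarrow>
      (a \<otimes>\<^bsub>K\<^esub> b) \<odot>\<^bsub>B\<^esub> x = a \<odot>\<^bsub>B\<^esub> (b \<odot>\<^bsub>B\<^esub> x)"
    and smult_one: "\<And>x. x \<in> carrier B \<Longrightarrow> \<one>\<^bsub>K\<^esub> \<odot>\<^bsub>B\<^esub> x = x"
    and mult_left: "\<And>c x y. c \<in> carrier K \<Longrightarrow> x \<in> carrier B \<Longrightarrow> y \<in> carrier B \<Longrightarrow>
      (c \<odot>\<^bsub>B\<^esub> x) \<otimes>\<^bsub>B\<^esub> y = c \<odot>\<^bsub>B\<^esub> (x \<otimes>\<^bsub>B\<^esub> y)"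
    and mult_right: "\<And>c x y. c \<in> carrier K \<Longrightarrow> x \<in> carrier B \<Longrightarrow> y \<in> carrier B \<Longrightarrow>
      x \<otimes>\<^bsub>B\<^esub> (c \<odot>\<^bsub>B\<^esub> y) = c \<odot>\<^bsub>B\<^esub> (x \<otimes>\<^bsub>B\<^esub> y)"
    and der_add: "\<And>d x y. d \<in> \<D> \<Longrightarrow> x \<in> carrier B \<Longrightarrow> y \<in> carrier B \<Longrightarrow>
      der B d (x \<oplus>\<^bsub>B\<^esub> y) = der B d x \<oplus>\<^bsub>B\<^esub> der B d y"
    and der_smult: "\<And>d c x. d \<in> \<D> \<Longrightarrow> c \<in> carrier K \<Longrightarrow> x \<in> carrier B \<Longrightarrow>
      der B d (c \<odot>\<^bsub>B\<^esub> x) = c \<odot>\<^bsub>B\<^esub> der B d x"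
    and der_mult: "\<And>d x y. d \<in> \<D> \<Longrightarrow> x \<in> carrier B \<Longrightarrow> y \<in> carrier B \<Longrightarrow>
      der B d (x \<otimes>\<^bsub>B\<^esub> y) = (der B d x \<otimes>\<^bsub>B\<^esub> y) \<oplus>\<^bsub>B\<^esub> (x \<otimes>\<^bsub>B\<^esub> der B d y)"
  shows "differential_algebra K \<D> B"
proof -
  have ab: "abelian_group B"
    by (rule abelian_groupI) (auto intro: assms)
  have mon: "monoid B"
    by (rule monoidI) (auto intro: assms)
  have "ring B"
    by (rule ringI[OF ab mon]) (auto intro: l_distr r_distr)
  moreover have "module K B"
    by (rule moduleI) (auto intro: assms ab field.axioms domain.axioms)
  ultimately have "associative_algebra K B"
    unfolding associative_algebra_def associative_algebra_axioms_def
    using \<open>field K\<close> mult_left mult_right by auto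
  then show ?thesis
    unfolding differential_algebra_def differential_algebra_axioms_def
    using der der_add der_smult der_mult by auto
qed

text \<open>Apart from closure and the existence of negatives the laws are equations, which a
  surjection carries over; negatives are images of negatives. The value at zero has to be assumed:
  \<open>ring_hom\<close> does not mention zero, and \<open>B\<close> is not yet known to be a
  group, where it would follow.\<close>

lemma differential_algebra_image:
  fixes C :: "('k, 'c, 'd) diff_algebra" and B :: "('k, 'b, 'd) diff_algebra"
  assumes C: "differential_algebra K \<D> C"
    and \<phi>: "\<phi> \<in> differential_hom K \<D> C B" "\<phi> ` carrier C = carrier B"
      "\<phi> \<zero>\<^bsub>C\<^esub> = \<zero>\<^bsub>B\<^esub>"
  shows "differential_algebra K \<D> B"
proof -
  interpret C: differential_algebra K \<D> C by fact
  have B: "carrier B = \<phi> ` carrier C" "\<zero>\<^bsub>B\<^esub> = \<phi> \<zero>\<^bsub>C\<^esub>" "\<one>\<^bsub>B\<^esub> = \<phi> \<one>\<^bsub>C\<^esub>"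
    using \<phi> by (auto simp: differential_hom_def ring_hom_def)
  have [simp]: "\<phi> x \<oplus>\<^bsub>B\<^esub> \<phi> y = \<phi> (x \<oplus>\<^bsub>C\<^esub> y)" "\<phi> x \<otimes>\<^bsub>B\<^esub> \<phi> y = \<phi> (x \<otimes>\<^bsub>C\<^esub> y)"
    if "x \<in> carrier C" "y \<in> carrier C" for x y
    using \<phi> that by (auto simp: differential_hom_def ring_hom_def)
  have [simp]: "c \<odot>\<^bsub>B\<^esub> \<phi> x = \<phi> (c \<odot>\<^bsub>C\<^esub> x)" if "c \<in> carrier K" "x \<in> carrier C" for c x
    using \<phi> that by (auto simp: differential_hom_def)
  have [simp]: "der B d (\<phi> x) = \<phi> (der C d x)" if "d \<in> \<D>" "x \<in> carrier C" for d x
    using \<phi> that by (auto simp: differential_hom_def)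
  show ?thesis
  proof (rule differential_algebraI)
    show "field K" by (rule C.field_axioms)
    show "\<exists>y\<in>carrier B. y \<oplus>\<^bsub>B\<^esub> x = \<zero>\<^bsub>B\<^esub>" if "x \<in> carrier B" for x
    proof -
      obtain x' where x': "x' \<in> carrier C" "x = \<phi> x'" using \<open>x \<in> carrier B\<close> unfolding B by auto
      then have "\<phi> (\<ominus>\<^bsub>C\<^esub> x') \<oplus>\<^bsub>B\<^esub> x = \<zero>\<^bsub>B\<^esub>" unfolding B by (simp add: C.M.l_neg)
      then show ?thesis using x' unfolding B by blast
    qed
  qed (unfold B, auto simp: C.M.a_assoc C.M.m_assoc C.M.l_distr C.M.r_distr
      C.smult_l_distr C.smult_r_distr C.smult_assoc1 C.smult_mult_left C.smult_mult_right
      C.der_closed C.der_add C.der_smult C.der_mult intro: arg_cong[OF C.M.a_comm])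
qed

lemma differential_subalgebra_algebra:
  assumes E: "differential_algebra K \<D> E" and S: "differential_subalgebra K \<D> E S"
  shows "differential_algebra K \<D> (E\<lparr>carrier := S\<rparr>)"
proof -
  interpret E: differential_algebra K \<D> E by fact
  have sub: "subring S E" and sm: "\<And>c x. c \<in> carrier K \<Longrightarrow> x \<in> S \<Longrightarrow> c \<odot>\<^bsub>E\<^esub> x \<in> S"
    and dr: "\<And>d x. d \<in> \<D> \<Longrightarrow> x \<in> S \<Longrightarrow> der E d x \<in> S"
    using S by (auto simp: differential_subalgebra_def)
  note SE = subringE[OF sub]
  have [simp]: "x \<in> carrier E" if "x \<in> S" for x using that SE(1) by auto
  show ?thesis
  proof (rule differential_algebraI)
    show "field K" by (rule E.field_axioms)
    show "\<exists>y\<in>carrier (E\<lparr>carrier := S\<rparr>). y \<oplus>\<^bsub>E\<lparr>carrier := S\<rparr>\<^esub> x = \<zero>\<^bsub>E\<lparr>carrier := S\<rparr>\<^esub>"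
      if "x \<in> carrier (E\<lparr>carrier := S\<rparr>)" for x
      using that SE(5)[of x] by (auto intro!: bexI[of _ "\<ominus>\<^bsub>E\<^esub> x"] simp: E.M.l_neg)
  qed (auto simp: SE sm dr E.M.a_assoc E.M.m_assoc E.M.l_distr E.M.r_distr
      E.smult_l_distr E.smult_r_distr E.smult_assoc1 E.smult_mult_left E.smult_mult_right
      E.der_add E.der_smult E.der_mult intro: E.M.a_comm)
qed

lemma differential_subalgebra_carrier:
  assumes "differential_algebra K \<D> A"
  shows "differential_subalgebra K \<D> A (carrier A)"
proof -
  interpret differential_algebra K \<D> A by fact
  show ?thesis
    by (auto simp: differential_subalgebra_def M.carrier_is_subring der_closed)
qed

lemma differential_subalgebra_Inter:
  assumes "differential_algebra K \<D> A" "\<S> \<noteq> {}" "\<And>S. S \<in> \<S> \<Longrightarrow> differential_subalgebra K \<D> A S"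
  shows "differential_subalgebra K \<D> A (\<Inter>\<S>)"
proof -
  interpret differential_algebra K \<D> A by fact
  show ?thesis
    using assms M.subring_Inter[of \<S>] unfolding differential_subalgebra_def by auto
qed

text \<open>Countably many operations of finite arity, iterated countably often on a countable set,
  reach only countably many elements.\<close>

lemma countable_differential_subalgebra:
  assumes "differential_algebra K \<D> A" and cK: "countable (carrier K)" and cD: "countable \<D>"
    and cY: "countable Y" and Y: "Y \<subseteq> carrier A"
  obtains S where "countable S" "Y \<subseteq> S" "differential_subalgebra K \<D> A S"
proof -
  interpret differential_algebra K \<D> A by fact
  \<comment> \<open>One round of all operations. Since \<open>F S\<close> contains \<open>S\<close>,
    the stages \<open>G n\<close> increase, and any two elements of their union meet in a common
    stage.\<close>
  define F where "F S = S \<union> (\<lambda>(x, y). x \<oplus>\<^bsub>A\<^esub> y) ` (S \<times> S) \<union> (\<lambda>(x, y). x \<otimes>\<^bsub>A\<^esub> y) ` (S \<times> S)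
    \<union> (\<lambda>x. \<ominus>\<^bsub>A\<^esub> x) ` S \<union> (\<lambda>(c, x). c \<odot>\<^bsub>A\<^esub> x) ` (carrier K \<times> S)
    \<union> (\<lambda>(d, x). der A d x) ` (\<D> \<times> S)" for S
  define G where "G n = (F ^^ n) (insert \<one>\<^bsub>A\<^esub> Y)" for n
  have G0: "G 0 = insert \<one>\<^bsub>A\<^esub> Y" and GS: "G (Suc n) = F (G n)" for n
    by (simp_all add: G_def)
  have cG: "countable (G n)" for n
    by (induction n) (use cY in \<open>auto simp: G0 GS F_def intro!: countable_image countable_SIGMA cK cD\<close>)
  have GA: "G n \<subseteq> carrier A" for n
  proof (induction n)
    case 0 then show ?case using Y by (simp add: G0)
  next
    case (Suc n) then show ?case by (auto simp: GS F_def subset_iff der_closed)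
  qed
  have mono: "G m \<subseteq> G n" if "m \<le> n" for m n
    using that using lift_Suc_mono_le[of G m n] by (auto simp: GS F_def)
  define S where "S = (\<Union>n. G n)"
  have step: "z \<in> S" if "z \<in> F (G n)" for z n
    using that GS[of n] unfolding S_def by blast
  have pair: "\<exists>n. x \<in> G n \<and> y \<in> G n" if "x \<in> S" "y \<in> S" for x y
  proof -
    obtain m n where "x \<in> G m" "y \<in> G n" using \<open>x \<in> S\<close> \<open>y \<in> S\<close> by (auto simp: S_def)
    then have "x \<in> G (max m n)" "y \<in> G (max m n)" using mono[of m "max m n"] mono[of n "max m n"] by auto
    then show ?thesis by blast
  qed
  have SA: "S \<subseteq> carrier A" using GA by (auto simp: S_def)
  have "subring S A"
  proof (rule M.subringI[OF SA])
    show "\<one>\<^bsub>A\<^esub> \<in> S" using G0 by (auto simp: S_def)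
    show "\<ominus>\<^bsub>A\<^esub> x \<in> S" if x: "x \<in> S" for x
    proof -
      obtain n where "x \<in> G n" using pair[OF x x] by blast
      then show ?thesis by (intro step[of _ n]) (simp add: F_def)
    qed
    fix x y assume "x \<in> S" "y \<in> S"
    then obtain n where n: "x \<in> G n" "y \<in> G n" using pair by blast
    have "x \<otimes>\<^bsub>A\<^esub> y \<in> F (G n)" "x \<oplus>\<^bsub>A\<^esub> y \<in> F (G n)"
      using n unfolding F_def by blast+
    then show "x \<otimes>\<^bsub>A\<^esub> y \<in> S" "x \<oplus>\<^bsub>A\<^esub> y \<in> S" by (auto intro: step)
  qed
  moreover have "c \<odot>\<^bsub>A\<^esub> x \<in> S" if "c \<in> carrier K" and x: "x \<in> S" for c x
  proof -
    obtain n where "x \<in> G n" using pair[OF x x] by blast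
    then have "c \<odot>\<^bsub>A\<^esub> x \<in> F (G n)" using \<open>c \<in> carrier K\<close> unfolding F_def by blast
    then show ?thesis by (rule step)
  qed
  moreover have "der A d x \<in> S" if "d \<in> \<D>" and x: "x \<in> S" for d x
  proof -
    obtain n where "x \<in> G n" using pair[OF x x] by blast
    then have "der A d x \<in> F (G n)" using \<open>d \<in> \<D>\<close> unfolding F_def by blast
    then show ?thesis by (rule step)
  qed
  ultimately have "differential_subalgebra K \<D> A S" by (auto simp: differential_subalgebra_def)
  moreover have "countable S" using cG by (auto simp: S_def)
  moreover have "Y \<subseteq> S" using G0 by (auto simp: S_def)
  ultimately show thesis using that by blast
qed

text \<open>The second claim needs an argument because its intersection runs over subalgebras of
  \<open>C\<close> instead of \<open>E\<close>. Each of them is also a subalgebra of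
  \<open>E\<close>, so if it contains \<open>Y\<close> it contains \<open>C\<close>.\<close>

lemma generated_differential_subalgebra:
  fixes E :: "('k, 'e, 'd) diff_algebra"
  assumes E: "differential_algebra K \<D> E" and Y: "Y \<subseteq> carrier E"
    and C: "C = \<Inter>{S. differential_subalgebra K \<D> E S \<and> Y \<subseteq> S}"
  shows "differential_subalgebra K \<D> E C"
    and "differential_generated_by K \<D> (E\<lparr>carrier := C\<rparr>) Y"
proof -
  interpret E: differential_algebra K \<D> E by fact
  show sub: "differential_subalgebra K \<D> E C"
    unfolding C using Y differential_subalgebra_carrier[OF E]
    by (intro differential_subalgebra_Inter[OF E]) blast+
  let ?C = "E\<lparr>carrier := C\<rparr>"
  have CE: "C \<subseteq> carrier E" using sub by (auto simp: differential_subalgebra_def dest: subringE(1))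
  have alg: "differential_algebra K \<D> ?C" by (rule differential_subalgebra_algebra[OF E sub])
  have "C \<subseteq> S" if S: "differential_subalgebra K \<D> ?C S" "Y \<subseteq> S" for S
  proof -
    have sr: "subring S ?C" and sm: "\<And>c x. c \<in> carrier K \<Longrightarrow> x \<in> S \<Longrightarrow> c \<odot>\<^bsub>E\<^esub> x \<in> S"
      and dr: "\<And>d x. d \<in> \<D> \<Longrightarrow> x \<in> S \<Longrightarrow> der E d x \<in> S"
      using S(1) by (simp_all add: differential_subalgebra_def)
    have SE: "S \<subseteq> carrier E" using subringE(1)[OF sr] CE by simp
    have "subring S E"
    proof (rule E.M.subringI[OF SE])
      show "\<ominus>\<^bsub>E\<^esub> x \<in> S" if "x \<in> S" for x
      \<comment> \<open>Negation in the restricted record is not literally negation in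
        \<open>E\<close>. Scalar multiplication is the same field in both records, so negatives are
        obtained by scaling with minus one.\<close>
      proof -
        have "(\<ominus>\<^bsub>K\<^esub> \<one>\<^bsub>K\<^esub>) \<odot>\<^bsub>E\<^esub> x \<in> S" by (rule sm) (use that in auto)
        moreover have "x \<in> carrier E" using that SE by blast
        ultimately show ?thesis by (simp add: E.smult_l_minus)
      qed
    qed (use subringE[OF sr] in simp_all)
    then have "differential_subalgebra K \<D> E S" using sm dr by (simp add: differential_subalgebra_def)
    then show ?thesis using S(2) unfolding C by blast
  qed
  moreover have "differential_subalgebra K \<D> ?C C"
    using differential_subalgebra_carrier[OF alg] by simp
  moreover have "Y \<subseteq> C" unfolding C by blast
  ultimately show "differential_generated_by K \<D> ?C Y"
    unfolding differential_generated_by_def by (simp, blast)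
qed

lemma countable_differential_algebra:
  assumes "differential_algebra K \<D> A" "countable (carrier K)" "countable \<D>" "countably_generated K \<D> A"
  shows "countable (carrier A)"
proof -
  obtain Y where Y: "countable Y" "differential_generated_by K \<D> A Y"
    using assms(4) by (auto simp: countably_generated_def)
  then have "Y \<subseteq> carrier A" by (simp add: differential_generated_by_def)
  then obtain S where "countable S" "Y \<subseteq> S" "differential_subalgebra K \<D> A S"
    using countable_differential_subalgebra[OF assms(1-3) Y(1)] by blast
  moreover from this have "carrier A \<subseteq> S" using Y(2) unfolding differential_generated_by_def by blast
  ultimately show ?thesis by (blast intro: countable_subset)
qed

section \<open>Simple quotients\<close>

text \<open>Sensible only if the fibres of \<open>\<phi>\<close> are the cosets of a differential ideal.\<close>

definition quotient_algebra ::
    "('k, 'c, 'd) diff_algebra \<Rightarrow> ('c \<Rightarrow> 'b) \<Rightarrow> ('k, 'b, 'd) diff_algebra" where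
  "quotient_algebra C \<phi> =
    (let s = inv_into (carrier C) \<phi> in
     \<lparr>carrier = \<phi> ` carrier C,
      monoid.mult = \<lambda>x y. \<phi> (s x \<otimes>\<^bsub>C\<^esub> s y), one = \<phi> \<one>\<^bsub>C\<^esub>,
      zero = \<phi> \<zero>\<^bsub>C\<^esub>, add = \<lambda>x y. \<phi> (s x \<oplus>\<^bsub>C\<^esub> s y),
      smult = \<lambda>c x. \<phi> (c \<odot>\<^bsub>C\<^esub> s x), der = \<lambda>d x. \<phi> (der C d (s x))\<rparr>)"

text \<open>The quotient of \<open>C\<close> by \<open>M\<close> is moved to \<open>nat\<close> by
  numbering the cosets. Countability of \<open>C\<close> makes the numbering injective, so equal
  values of \<phi> mean a difference in \<open>M\<close>.\<close>

lemma exists_quotient_algebra: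
  fixes C :: "('k, 'c, 'd) diff_algebra"
  assumes C: "differential_algebra K \<D> C" and M: "ideal M C"
    and dM: "\<And>d x. d \<in> \<D> \<Longrightarrow> x \<in> M \<Longrightarrow> der C d x \<in> M"
    and cC: "countable (carrier C)"
  obtains B :: "('k, nat, 'd) diff_algebra" and \<phi>
  where "differential_algebra K \<D> B" "\<phi> \<in> differential_hom K \<D> C B"
    "\<phi> ` carrier C = carrier B" "\<And>x. x \<in> carrier C \<Longrightarrow> \<phi> x = \<zero>\<^bsub>B\<^esub> \<longleftrightarrow> x \<in> M"
proof -
  interpret C: differential_algebra K \<D> C by fact
  interpret M: ideal M C by fact
  have M_in [simp]: "x \<in> carrier C" if "x \<in> M" for x using that M.Icarr by blast
  define \<phi> where "\<phi> x = to_nat_on ((\<lambda>x. M +>\<^bsub>C\<^esub> x) ` carrier C) (M +>\<^bsub>C\<^esub> x)" for x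
  have \<phi>_eq: "\<phi> x = \<phi> y \<longleftrightarrow> x \<ominus>\<^bsub>C\<^esub> y \<in> M" if "x \<in> carrier C" "y \<in> carrier C" for x y
  proof -
    have "\<phi> x = \<phi> y \<longleftrightarrow> M +>\<^bsub>C\<^esub> x = M +>\<^bsub>C\<^esub> y"
      unfolding \<phi>_def by (rule inj_on_eq_iff[OF inj_on_to_nat_on]) (use that cC in auto)
    also have "\<dots> \<longleftrightarrow> x \<ominus>\<^bsub>C\<^esub> y \<in> M"
      using C.M.quotient_eq_iff_same_a_r_cos[OF M that] by simp
    finally show ?thesis .
  qed
  \<comment> \<open>\<open>s\<close> picks a representative of each coset, which differs from the
    given element by a member of \<open>M\<close>. The homomorphism laws then say that the
    operations of \<open>C\<close> respect congruence modulo \<open>M\<close>.\<close>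
  define s where "s = inv_into (carrier C) \<phi>"
  have s: "s (\<phi> x) \<in> carrier C" "s (\<phi> x) \<ominus>\<^bsub>C\<^esub> x \<in> M" if "x \<in> carrier C" for x
  proof -
    have *: "\<phi> x \<in> \<phi> ` carrier C" using that by auto
    show "s (\<phi> x) \<in> carrier C" unfolding s_def by (rule inv_into_into[OF *])
    then show "s (\<phi> x) \<ominus>\<^bsub>C\<^esub> x \<in> M" using f_inv_into_f[OF *] that by (simp add: \<phi>_eq[symmetric] s_def)
  qed
  let ?B = "quotient_algebra C \<phi>"
  have B: "carrier ?B = \<phi> ` carrier C" "\<zero>\<^bsub>?B\<^esub> = \<phi> \<zero>\<^bsub>C\<^esub>" "\<one>\<^bsub>?B\<^esub> = \<phi> \<one>\<^bsub>C\<^esub>"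
    "x \<oplus>\<^bsub>?B\<^esub> y = \<phi> (s x \<oplus>\<^bsub>C\<^esub> s y)" "x \<otimes>\<^bsub>?B\<^esub> y = \<phi> (s x \<otimes>\<^bsub>C\<^esub> s y)"
    "c \<odot>\<^bsub>?B\<^esub> x = \<phi> (c \<odot>\<^bsub>C\<^esub> s x)" "der ?B d x = \<phi> (der C d (s x))" for x y c d
    by (simp_all add: quotient_algebra_def s_def Let_def)
  have der_neg: "der C d (\<ominus>\<^bsub>C\<^esub> x) = \<ominus>\<^bsub>C\<^esub> der C d x" if "d \<in> \<D>" "x \<in> carrier C" for d x
  proof -
    have "der C d ((\<ominus>\<^bsub>K\<^esub> \<one>\<^bsub>K\<^esub>) \<odot>\<^bsub>C\<^esub> x) = (\<ominus>\<^bsub>K\<^esub> \<one>\<^bsub>K\<^esub>) \<odot>\<^bsub>C\<^esub> der C d x"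
      using that by (intro C.der_smult) auto
    then show ?thesis using that by (simp add: C.smult_l_minus C.der_closed)
  qed
  have hom: "\<phi> \<in> differential_hom K \<D> C ?B"
    unfolding differential_hom_def ring_hom_def
  proof (safe; (simp add: B)?)
    fix x y assume x: "x \<in> carrier C" and y: "y \<in> carrier C"
    note sx = s[OF x] and sy = s[OF y]
    \<comment> \<open>With representatives x' and y' this reads x' y' - x y = (x' - x) y' + x (y' -
      y), so absorption on both sides is used.\<close>
    have "(s (\<phi> x) \<otimes>\<^bsub>C\<^esub> s (\<phi> y)) \<ominus>\<^bsub>C\<^esub> (x \<otimes>\<^bsub>C\<^esub> y) =
      ((s (\<phi> x) \<ominus>\<^bsub>C\<^esub> x) \<otimes>\<^bsub>C\<^esub> s (\<phi> y)) \<oplus>\<^bsub>C\<^esub> (x \<otimes>\<^bsub>C\<^esub> (s (\<phi> y) \<ominus>\<^bsub>C\<^esub> y))"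
      using x y sx sy by algebra
    also have "\<dots> \<in> M"
      using x y sx sy by (intro M.a_closed M.I_l_closed M.I_r_closed)
    finally show "\<phi> (x \<otimes>\<^bsub>C\<^esub> y) = \<phi> (s (\<phi> x) \<otimes>\<^bsub>C\<^esub> s (\<phi> y))"
      using x y sx sy by (simp add: \<phi>_eq[symmetric])
    have "(s (\<phi> x) \<oplus>\<^bsub>C\<^esub> s (\<phi> y)) \<ominus>\<^bsub>C\<^esub> (x \<oplus>\<^bsub>C\<^esub> y) =
      (s (\<phi> x) \<ominus>\<^bsub>C\<^esub> x) \<oplus>\<^bsub>C\<^esub> (s (\<phi> y) \<ominus>\<^bsub>C\<^esub> y)"
      using x y sx sy by algebra
    also have "\<dots> \<in> M" using sx sy by (intro M.a_closed)
    finally show "\<phi> (x \<oplus>\<^bsub>C\<^esub> y) = \<phi> (s (\<phi> x) \<oplus>\<^bsub>C\<^esub> s (\<phi> y))"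
      using x y sx sy by (simp add: \<phi>_eq[symmetric])
  next
    fix c x assume c: "c \<in> carrier K" and x: "x \<in> carrier C"
    note sx = s[OF x]
    \<comment> \<open>An ideal is not assumed to be a subspace. Scaling by \<open>c\<close> is
      multiplication by \<open>c\<close> times the unit, and that is absorbed by
      \<open>M\<close>.\<close>
    have "(c \<odot>\<^bsub>C\<^esub> s (\<phi> x)) \<ominus>\<^bsub>C\<^esub> (c \<odot>\<^bsub>C\<^esub> x) = (c \<odot>\<^bsub>C\<^esub> \<one>\<^bsub>C\<^esub>) \<otimes>\<^bsub>C\<^esub> (s (\<phi> x) \<ominus>\<^bsub>C\<^esub> x)"
      using c x sx by (simp add: C.smult_mult_left a_minus_def C.smult_r_distr C.smult_r_minus)
    also have "\<dots> \<in> M" using c x sx by (intro M.I_l_closed) auto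
    finally show "\<phi> (c \<odot>\<^bsub>C\<^esub> x) = \<phi> (c \<odot>\<^bsub>C\<^esub> s (\<phi> x))"
      using c x sx by (simp add: \<phi>_eq[symmetric])
  next
    fix d x assume d: "d \<in> \<D>" and x: "x \<in> carrier C"
    note sx = s[OF x]
    have "der C d (s (\<phi> x)) \<ominus>\<^bsub>C\<^esub> der C d x = der C d (s (\<phi> x) \<ominus>\<^bsub>C\<^esub> x)"
      using d x sx by (simp add: a_minus_def C.der_add der_neg)
    also have "\<dots> \<in> M" using d sx by (intro dM)
    finally show "\<phi> (der C d x) = \<phi> (der C d (s (\<phi> x)))"
      using d x sx by (simp add: \<phi>_eq[symmetric] C.der_closed)
  qed
  show thesis
  proof (rule that[of ?B \<phi>])
    show "differential_algebra K \<D> ?B"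
      by (rule differential_algebra_image[OF C hom]) (simp_all add: B)
    show "\<phi> x = \<zero>\<^bsub>?B\<^esub> \<longleftrightarrow> x \<in> M" if "x \<in> carrier C" for x
      using that \<phi>_eq[of x "\<zero>\<^bsub>C\<^esub>"] by (simp add: B a_minus_def)
  qed (simp_all add: B hom)
qed

text \<open>Zorn's lemma applies because properness is expressed as not containing the unit, a
  condition that passes to unions of chains.\<close>

lemma exists_maximal_differential_ideal:
  fixes C :: "('k, 'c, 'd) diff_algebra"
  assumes "differential_algebra K \<D> C" and ne: "\<one>\<^bsub>C\<^esub> \<noteq> \<zero>\<^bsub>C\<^esub>"
  obtains M where "ideal M C" "\<And>d x. d \<in> \<D> \<Longrightarrow> x \<in> M \<Longrightarrow> der C d x \<in> M" "\<one>\<^bsub>C\<^esub> \<notin> M"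
    "\<And>I. ideal I C \<Longrightarrow> (\<And>d x. d \<in> \<D> \<Longrightarrow> x \<in> I \<Longrightarrow> der C d x \<in> I) \<Longrightarrow> M \<subseteq> I \<Longrightarrow> \<one>\<^bsub>C\<^esub> \<notin> I \<Longrightarrow> I = M"
proof -
  interpret C: differential_algebra K \<D> C by fact
  let ?P = "{I. ideal I C \<and> (\<forall>d\<in>\<D>. \<forall>x\<in>I. der C d x \<in> I) \<and> \<one>\<^bsub>C\<^esub> \<notin> I}"
  have "\<exists>M\<in>?P. \<forall>I\<in>?P. M \<subseteq> I \<longrightarrow> I = M"
  proof (rule subset_Zorn_nonempty)
    \<comment> \<open>Taking both scalar and vector to be zero in linearity shows that derivations
      kill zero, so the zero ideal belongs to the family.\<close>
    have "der C d \<zero>\<^bsub>C\<^esub> = \<zero>\<^bsub>C\<^esub>" if "d \<in> \<D>" for d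
      using C.der_smult[OF that C.R.zero_closed C.M.zero_closed] that by (simp add: C.der_closed)
    then have "{\<zero>\<^bsub>C\<^esub>} \<in> ?P" using C.M.zeroideal ne by auto
    then show "?P \<noteq> {}" by blast
    fix \<C> assume cne: "\<C> \<noteq> {}" and ch: "subset.chain ?P \<C>"
    have sub: "\<C> \<subseteq> ?P" using ch by (simp add: subset.chain_def)
    then have idl: "ideal I C" if "I \<in> \<C>" for I using that by auto
    \<comment> \<open>Closure of the union under addition is the one place where the members of the
      chain must be comparable.\<close>
    have pair: "\<exists>I\<in>\<C>. x \<in> I \<and> y \<in> I" if xy: "x \<in> \<Union>\<C>" "y \<in> \<Union>\<C>" for x y
    proof -
      obtain I J where IJ: "I \<in> \<C>" "x \<in> I" "J \<in> \<C>" "y \<in> J" using xy by auto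
      then have "I \<subseteq> J \<or> J \<subseteq> I" using ch unfolding subset_chain_def by auto
      then show ?thesis using IJ by blast
    qed
    have "ideal (\<Union>\<C>) C"
    proof (rule idealI[OF C.M.ring_axioms])
      show "subgroup (\<Union>\<C>) (add_monoid C)"
      proof (rule C.M.add.subgroupI)
        show "\<Union>\<C> \<subseteq> carrier C"
        proof
          fix x assume "x \<in> \<Union>\<C>"
          then obtain I where "I \<in> \<C>" "x \<in> I" by blast
          then show "x \<in> carrier C" using ideal.Icarr[OF idl] by blast
        qed
        obtain I where I: "I \<in> \<C>" using cne by auto
        interpret I: ideal I C by (rule idl[OF I])
        show "\<Union>\<C> \<noteq> {}" using I I.zero_closed by blast
      next
        fix x assume "x \<in> \<Union>\<C>"
        then obtain I where I: "I \<in> \<C>" "x \<in> I" by blast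
        interpret I: ideal I C by (rule idl[OF I(1)])
        show "\<ominus>\<^bsub>C\<^esub> x \<in> \<Union>\<C>" using I I.a_inv_closed by blast
      next
        fix x y assume "x \<in> \<Union>\<C>" "y \<in> \<Union>\<C>"
        then obtain I where I: "I \<in> \<C>" "x \<in> I" "y \<in> I" using pair by blast
        interpret I: ideal I C by (rule idl[OF I(1)])
        show "x \<oplus>\<^bsub>C\<^esub> y \<in> \<Union>\<C>" using I I.a_closed by blast
      qed
    next
      fix a x assume "a \<in> \<Union>\<C>" and x: "x \<in> carrier C"
      then obtain I where I: "I \<in> \<C>" "a \<in> I" by blast
      interpret I: ideal I C by (rule idl[OF I(1)])
      show "x \<otimes>\<^bsub>C\<^esub> a \<in> \<Union>\<C>" "a \<otimes>\<^bsub>C\<^esub> x \<in> \<Union>\<C>"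
        using I x I.I_l_closed I.I_r_closed by blast+
    qed
    moreover have "\<forall>d\<in>\<D>. \<forall>x\<in>\<Union>\<C>. der C d x \<in> \<Union>\<C>" "\<one>\<^bsub>C\<^esub> \<notin> \<Union>\<C>"
      using sub by auto
    ultimately show "\<Union>\<C> \<in> ?P" by simp
  qed
  then obtain M where M: "M \<in> ?P" and max: "\<forall>I\<in>?P. M \<subseteq> I \<longrightarrow> I = M" by (rule bexE)
  show thesis
  proof (rule that)
    show "I = M" if "ideal I C" "\<And>d x. d \<in> \<D> \<Longrightarrow> x \<in> I \<Longrightarrow> der C d x \<in> I" "M \<subseteq> I" "\<one>\<^bsub>C\<^esub> \<notin> I" for I
      using max that by simp
  qed (use M in simp_all)
qed

text \<open>The maximal ideal stays hidden: all that is exported about the kernel is the last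
  conclusion, which holds because the kernel is an ideal without the unit.\<close>

lemma exists_simple_quotient:
  fixes C :: "('k, 'c, 'd) diff_algebra"
  assumes C: "differential_algebra K \<D> C" and ne: "\<one>\<^bsub>C\<^esub> \<noteq> \<zero>\<^bsub>C\<^esub>"
    and cC: "countable (carrier C)" and gen: "two_generated K \<D> C"
  obtains B :: "('k, nat, 'd) diff_algebra" and \<phi>
  where "differential_algebra K \<D> B" "simple_differential_algebra \<D> B" "two_generated K \<D> B"
    "\<phi> \<in> differential_hom K \<D> C B"
    "\<And>u x v. u \<in> carrier C \<Longrightarrow> x \<in> carrier C \<Longrightarrow> v \<in> carrier C \<Longrightarrow>
       u \<otimes>\<^bsub>C\<^esub> x \<otimes>\<^bsub>C\<^esub> v = \<one>\<^bsub>C\<^esub> \<Longrightarrow> \<phi> x \<noteq> \<zero>\<^bsub>B\<^esub>"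
proof -
  interpret C: differential_algebra K \<D> C by fact
  obtain M where M: "ideal M C" "\<And>d x. d \<in> \<D> \<Longrightarrow> x \<in> M \<Longrightarrow> der C d x \<in> M" "\<one>\<^bsub>C\<^esub> \<notin> M"
    and max: "\<And>I. ideal I C \<Longrightarrow> (\<And>d x. d \<in> \<D> \<Longrightarrow> x \<in> I \<Longrightarrow> der C d x \<in> I) \<Longrightarrow> M \<subseteq> I \<Longrightarrow> \<one>\<^bsub>C\<^esub> \<notin> I \<Longrightarrow> I = M"
    using exists_maximal_differential_ideal[OF C ne] by metis
  interpret M: ideal M C by fact
  obtain B :: "('k, nat, 'd) diff_algebra" and \<phi> where B: "differential_algebra K \<D> B"
    and \<phi>: "\<phi> \<in> differential_hom K \<D> C B" "\<phi> ` carrier C = carrier B"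
    and ker: "\<And>x. x \<in> carrier C \<Longrightarrow> \<phi> x = \<zero>\<^bsub>B\<^esub> \<longleftrightarrow> x \<in> M"
    using exists_quotient_algebra[OF C M(1,2) cC] by blast
  interpret B: differential_algebra K \<D> B by fact
  have \<phi>_hom: "\<And>x. x \<in> carrier C \<Longrightarrow> \<phi> x \<in> carrier B" "\<phi> \<one>\<^bsub>C\<^esub> = \<one>\<^bsub>B\<^esub>"
    "\<And>x y. x \<in> carrier C \<Longrightarrow> y \<in> carrier C \<Longrightarrow> \<phi> (x \<oplus>\<^bsub>C\<^esub> y) = \<phi> x \<oplus>\<^bsub>B\<^esub> \<phi> y"
    "\<And>x y. x \<in> carrier C \<Longrightarrow> y \<in> carrier C \<Longrightarrow> \<phi> (x \<otimes>\<^bsub>C\<^esub> y) = \<phi> x \<otimes>\<^bsub>B\<^esub> \<phi> y"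
    "\<And>c x. c \<in> carrier K \<Longrightarrow> x \<in> carrier C \<Longrightarrow> \<phi> (c \<odot>\<^bsub>C\<^esub> x) = c \<odot>\<^bsub>B\<^esub> \<phi> x"
    "\<And>d x. d \<in> \<D> \<Longrightarrow> x \<in> carrier C \<Longrightarrow> \<phi> (der C d x) = der B d (\<phi> x)"
    using \<phi>(1) by (auto simp: differential_hom_def ring_hom_def)
  interpret \<phi>: ring_hom_ring C B \<phi>
    by (rule ring_hom_ringI[OF C.M.ring_axioms B.M.ring_axioms]) (use \<phi>_hom in auto)
  show thesis
  proof (rule that[OF B _ _ \<phi>(1)])
    have "\<one>\<^bsub>B\<^esub> \<noteq> \<zero>\<^bsub>B\<^esub>" using ker[of "\<one>\<^bsub>C\<^esub>"] M(3) \<phi>_hom(2) by auto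
    moreover have "I = {\<zero>\<^bsub>B\<^esub>} \<or> I = carrier B"
      if I: "ideal I B" "\<forall>d \<in> \<D>. \<forall>x \<in> I. der B d x \<in> I" for I
    proof -
      interpret I: ideal I B by fact
      \<comment> \<open>The preimage of \<open>I\<close> is a differential ideal above
        \<open>M\<close>. Either it contains the unit, and then \<open>I\<close> is everything, or
        it equals \<open>M\<close> by maximality, and then \<open>I\<close> is zero.\<close>
      let ?J = "{x \<in> carrier C. \<phi> x \<in> I}"
      have J: "ideal ?J C"
      proof (rule idealI[OF C.M.ring_axioms])
        show "subgroup ?J (add_monoid C)"
          by (rule C.M.add.subgroupI) (auto intro!: exI[of _ "\<zero>\<^bsub>C\<^esub>"])
      qed (auto simp: I.I_l_closed I.I_r_closed)
      have MJ: "M \<subseteq> ?J"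
      proof
        fix x assume x: "x \<in> M"
        then have "\<phi> x = \<zero>\<^bsub>B\<^esub>" using ker[OF M.Icarr[OF x]] by blast
        then show "x \<in> ?J" using M.Icarr[OF x] I.zero_closed by simp
      qed
      have dJ: "der C d x \<in> ?J" if "d \<in> \<D>" "x \<in> ?J" for d x
        using that I(2) by (auto simp: C.der_closed \<phi>_hom(6))
      show ?thesis
      proof (cases "\<one>\<^bsub>C\<^esub> \<in> ?J")
        case True
        then have "\<one>\<^bsub>B\<^esub> \<in> I" by (simp add: \<phi>_hom)
        then show ?thesis using I.one_imp_carrier by auto
      next
        case False
        then have "?J = M" by (intro max J dJ MJ)
        have "x = \<zero>\<^bsub>B\<^esub>" if "x \<in> I" for x
        proof -
          obtain x' where "x' \<in> carrier C" "x = \<phi> x'" using I.Icarr[OF \<open>x \<in> I\<close>] \<phi>(2) by auto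
          then show ?thesis using \<open>?J = M\<close> ker[of x'] \<open>x \<in> I\<close> by auto
        qed
        then show ?thesis using I.zero_closed by auto
      qed
    qed
    ultimately show "simple_differential_algebra \<D> B"
      unfolding simple_differential_algebra_def using B.M.one_closed by auto
    obtain a b where ab: "differential_generated_by K \<D> C {a, b}" using gen by (auto simp: two_generated_def)
    then have abC: "a \<in> carrier C" "b \<in> carrier C" by (auto simp: differential_generated_by_def)
    have "carrier B \<subseteq> S" if S: "differential_subalgebra K \<D> B S" "{\<phi> a, \<phi> b} \<subseteq> S" for S
    proof -
      have sub: "subring S B" using S by (simp add: differential_subalgebra_def)
      \<comment> \<open>Generation passes to the image by the same pullback: the preimage of a
        subalgebra is a subalgebra, and it contains \<open>a\<close> and \<open>b\<close>.\<close>
      let ?T = "{x \<in> carrier C. \<phi> x \<in> S}"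
      have "subring ?T C"
        by (rule C.M.subringI) (auto simp: subringE[OF sub] \<phi>_hom)
      then have "differential_subalgebra K \<D> C ?T"
        using S(1) by (auto simp: differential_subalgebra_def \<phi>_hom C.der_closed)
      moreover have "{a, b} \<subseteq> ?T" using S(2) abC by auto
      ultimately have "carrier C \<subseteq> ?T" using ab unfolding differential_generated_by_def by blast
      then show ?thesis unfolding \<phi>(2)[symmetric] by blast
    qed
    then have "differential_generated_by K \<D> B {\<phi> a, \<phi> b}"
      unfolding differential_generated_by_def
      using abC \<phi>_hom(1) differential_subalgebra_carrier[OF B] by blast
    then show "two_generated K \<D> B" unfolding two_generated_def by blast
    show "\<phi> x \<noteq> \<zero>\<^bsub>B\<^esub>" if "u \<in> carrier C" "x \<in> carrier C" "v \<in> carrier C"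
      "u \<otimes>\<^bsub>C\<^esub> x \<otimes>\<^bsub>C\<^esub> v = \<one>\<^bsub>C\<^esub>" for u x v
      using ker[OF that(2)] M(3) M.I_l_closed M.I_r_closed that by metis
  qed
qed

section \<open>Finitely supported functions and coordinates\<close>

text \<open>Only \<open>carrier\<close> and \<open>zero\<close> of the record are used, so the same
  set serves for coefficient families over the field and for vectors of the direct power.\<close>

definition finite_support :: "('k, 'm) ring_scheme \<Rightarrow> ('i \<Rightarrow> 'k) set" where
  "finite_support K = {f. (\<forall>i. f i \<in> carrier K) \<and> finite {i. f i \<noteq> \<zero>\<^bsub>K\<^esub>}}"

definition support_sum :: "('a, 'm) ring_scheme \<Rightarrow> ('i \<Rightarrow> 'a) \<Rightarrow> 'a" where
  "support_sum M f = (\<Oplus>\<^bsub>M\<^esub>i\<in>{i. f i \<noteq> \<zero>\<^bsub>M\<^esub>}. f i)"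

lemma finite_supportI:
  assumes "\<And>i. f i \<in> carrier M" "finite S" "\<And>i. i \<notin> S \<Longrightarrow> f i = \<zero>\<^bsub>M\<^esub>"
  shows "f \<in> finite_support M"
  using assms by (auto simp: finite_support_def intro: finite_subset[of _ S])

lemma finite_supportD:
  assumes "f \<in> finite_support M"
  shows "f i \<in> carrier M" "finite {i. f i \<noteq> \<zero>\<^bsub>M\<^esub>}"
  using assms by (auto simp: finite_support_def)

context abelian_monoid
begin

text \<open>Any finite set around the support is allowed, so that two families can be summed over a
  common index set.\<close>

lemma support_sum_eq:
  assumes "f \<in> finite_support G" "finite S" "\<And>i. i \<notin> S \<Longrightarrow> f i = \<zero>"
  shows "support_sum G f = (\<Oplus>i\<in>S. f i)"
  unfolding support_sum_def
  by (rule add.finprod_mono_neutral_cong_left) (use assms in \<open>auto simp: finite_support_def\<close>)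

lemma support_sum_closed [simp]: "f \<in> finite_support G \<Longrightarrow> support_sum G f \<in> carrier G"
  unfolding support_sum_def by (rule finsum_closed) (auto simp: finite_support_def)

lemma finite_support_add:
  assumes "f \<in> finite_support G" "g \<in> finite_support G"
  shows "(\<lambda>i. f i \<oplus> g i) \<in> finite_support G"
  by (rule finite_supportI[of _ _ "{i. f i \<noteq> \<zero>} \<union> {i. g i \<noteq> \<zero>}"])
    (use assms in \<open>auto simp: finite_support_def\<close>)

lemma support_sum_add:
  assumes "f \<in> finite_support G" "g \<in> finite_support G"
  shows "support_sum G (\<lambda>i. f i \<oplus> g i) = support_sum G f \<oplus> support_sum G g"
proof -
  let ?S = "{i. f i \<noteq> \<zero>} \<union> {i. g i \<noteq> \<zero>}"
  have S: "finite ?S" using assms by (auto simp: finite_support_def)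
  have "support_sum G (\<lambda>i. f i \<oplus> g i) = (\<Oplus>i\<in>?S. f i \<oplus> g i)"
    by (rule support_sum_eq[OF finite_support_add[OF assms] S]) auto
  also have "\<dots> = (\<Oplus>i\<in>?S. f i) \<oplus> (\<Oplus>i\<in>?S. g i)"
    by (rule finsum_addf) (use assms in \<open>auto simp: finite_support_def\<close>)
  also have "(\<Oplus>i\<in>?S. f i) = support_sum G f"
    by (rule support_sum_eq[OF assms(1) S, symmetric]) auto
  also have "(\<Oplus>i\<in>?S. g i) = support_sum G g"
    by (rule support_sum_eq[OF assms(2) S, symmetric]) auto
  finally show ?thesis .
qed

lemma support_sum_single:
  assumes "f j \<in> carrier G" "\<And>i. i \<noteq> j \<Longrightarrow> f i = \<zero>"
  shows "support_sum G f = f j"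
proof -
  have f: "f i \<in> carrier G" for i using assms by (cases "i = j") auto
  have "f \<in> finite_support G" by (rule finite_supportI[of _ _ "{j}"]) (use f assms in auto)
  then have "support_sum G f = (\<Oplus>i\<in>{j}. f i)"
    by (rule support_sum_eq) (use assms in auto)
  then show ?thesis using f by (simp add: finsum_insert)
qed

end

context module
begin

lemma finite_support_smult:
  assumes "c \<in> carrier R" "f \<in> finite_support M"
  shows "(\<lambda>i. c \<odot>\<^bsub>M\<^esub> f i) \<in> finite_support M"
  by (rule finite_supportI[of _ _ "{i. f i \<noteq> \<zero>\<^bsub>M\<^esub>}"])
    (use assms in \<open>auto simp: finite_support_def\<close>)

lemma support_sum_smult:
  assumes "c \<in> carrier R" "f \<in> finite_support M"
  shows "support_sum M (\<lambda>i. c \<odot>\<^bsub>M\<^esub> f i) = c \<odot>\<^bsub>M\<^esub> support_sum M f"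
proof -
  let ?S = "{i. f i \<noteq> \<zero>\<^bsub>M\<^esub>}"
  have S: "finite ?S" using assms by (auto simp: finite_support_def)
  have "support_sum M (\<lambda>i. c \<odot>\<^bsub>M\<^esub> f i) = (\<Oplus>\<^bsub>M\<^esub>i\<in>?S. c \<odot>\<^bsub>M\<^esub> f i)"
    by (rule M.support_sum_eq[OF finite_support_smult[OF assms] S]) (use assms in auto)
  also have "\<dots> = c \<odot>\<^bsub>M\<^esub> support_sum M f"
    unfolding support_sum_def
    by (rule finsum_smult_ldistr[symmetric]) (use assms S in \<open>auto simp: finite_support_def\<close>)
  finally show ?thesis .
qed

lemma finite_support_combination:
  assumes "f \<in> finite_support R" "\<And>i. e i \<in> carrier M"
  shows "(\<lambda>i. f i \<odot>\<^bsub>M\<^esub> e i) \<in> finite_support M"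
  by (rule finite_supportI[of _ _ "{i. f i \<noteq> \<zero>}"])
    (use assms in \<open>auto simp: finite_support_def\<close>)

lemma combination_add:
  assumes "f \<in> finite_support R" "g \<in> finite_support R" "\<And>i. e i \<in> carrier M"
  shows "support_sum M (\<lambda>i. (f i \<oplus> g i) \<odot>\<^bsub>M\<^esub> e i) =
    support_sum M (\<lambda>i. f i \<odot>\<^bsub>M\<^esub> e i) \<oplus>\<^bsub>M\<^esub> support_sum M (\<lambda>i. g i \<odot>\<^bsub>M\<^esub> e i)"
proof -
  have "support_sum M (\<lambda>i. (f i \<oplus> g i) \<odot>\<^bsub>M\<^esub> e i) =
    support_sum M (\<lambda>i. f i \<odot>\<^bsub>M\<^esub> e i \<oplus>\<^bsub>M\<^esub> g i \<odot>\<^bsub>M\<^esub> e i)"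
    using assms by (simp add: smult_l_distr finite_supportD)
  also have "\<dots> = support_sum M (\<lambda>i. f i \<odot>\<^bsub>M\<^esub> e i) \<oplus>\<^bsub>M\<^esub> support_sum M (\<lambda>i. g i \<odot>\<^bsub>M\<^esub> e i)"
    by (rule M.support_sum_add) (use assms in \<open>auto intro: finite_support_combination\<close>)
  finally show ?thesis .
qed

lemma finite_support_scale:
  assumes "c \<in> carrier R" "f \<in> finite_support R"
  shows "(\<lambda>i. c \<otimes> f i) \<in> finite_support R"
  by (rule finite_supportI[of _ _ "{i. f i \<noteq> \<zero>}"])
    (use assms in \<open>auto simp: finite_support_def\<close>)

lemma combination_scale:
  assumes "c \<in> carrier R" "f \<in> finite_support R" "\<And>i. e i \<in> carrier M"
  shows "support_sum M (\<lambda>i. (c \<otimes> f i) \<odot>\<^bsub>M\<^esub> e i) = c \<odot>\<^bsub>M\<^esub> support_sum M (\<lambda>i. f i \<odot>\<^bsub>M\<^esub> e i)"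
proof -
  have "support_sum M (\<lambda>i. (c \<otimes> f i) \<odot>\<^bsub>M\<^esub> e i) = support_sum M (\<lambda>i. c \<odot>\<^bsub>M\<^esub> (f i \<odot>\<^bsub>M\<^esub> e i))"
    using assms by (simp add: smult_assoc1 finite_supportD)
  also have "\<dots> = c \<odot>\<^bsub>M\<^esub> support_sum M (\<lambda>i. f i \<odot>\<^bsub>M\<^esub> e i)"
    by (rule support_sum_smult) (use assms in \<open>auto intro: finite_support_combination\<close>)
  finally show ?thesis .
qed

lemma combination_unit:
  assumes "\<And>i. e i \<in> carrier M"
  shows "(\<lambda>i. if i = j then \<one> else \<zero>) \<in> finite_support R"
    and "support_sum M (\<lambda>i. (if i = j then \<one> else \<zero>) \<odot>\<^bsub>M\<^esub> e i) = e j"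
proof -
  show "(\<lambda>i. if i = j then \<one> else \<zero>) \<in> finite_support R"
    by (rule finite_supportI[of _ _ "{j}"]) auto
  show "support_sum M (\<lambda>i. (if i = j then \<one> else \<zero>) \<odot>\<^bsub>M\<^esub> e i) = e j"
    using assms by (subst M.support_sum_single[of _ j]) auto
qed

end

text \<open>
  Coordinates with respect to a maximal independent subfamily of the spanning family \<open>e\<close>; the
  coordinates at indices outside the subfamily vanish identically.
\<close>

lemma (in module) exists_coordinates:
  fixes e :: "'i \<Rightarrow> 'c"
  assumes "field R" and e: "range e = carrier M"
  obtains c :: "'i \<Rightarrow> 'c \<Rightarrow> 'a"
  where "\<And>x. x \<in> carrier M \<Longrightarrow> (\<lambda>i. c i x) \<in> finite_support R"
    and "\<And>i x y. x \<in> carrier M \<Longrightarrow> y \<in> carrier M \<Longrightarrow> c i (x \<oplus>\<^bsub>M\<^esub> y) = c i x \<oplus> c i y"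
    and "\<And>i a x. a \<in> carrier R \<Longrightarrow> x \<in> carrier M \<Longrightarrow> c i (a \<odot>\<^bsub>M\<^esub> x) = a \<otimes> c i x"
    and "\<And>x. x \<in> carrier M \<Longrightarrow> support_sum M (\<lambda>i. c i x \<odot>\<^bsub>M\<^esub> e i) = x"
proof -
  interpret field R by fact
  have eM: "e i \<in> carrier M" for i using e by auto
  \<comment> \<open>Families on \<open>J\<close> are total functions vanishing off \<open>J\<close>,
    so that all of them share one type while \<open>J\<close> varies. Independence concerns indices,
    not vectors; hence \<open>e\<close> may have repetitions.\<close>
  define on where "on J = {f \<in> finite_support R. \<forall>i. i \<notin> J \<longrightarrow> f i = \<zero>}" for J :: "'i set"
  define comb where "comb f = support_sum M (\<lambda>i. f i \<odot>\<^bsub>M\<^esub> e i)" for f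
  have comb_closed: "comb f \<in> carrier M" if "f \<in> on J" for f J
    using that eM unfolding comb_def on_def by (auto intro: M.support_sum_closed finite_support_combination)
  have on_add: "(\<lambda>i. f i \<oplus> g i) \<in> on J" "comb (\<lambda>i. f i \<oplus> g i) = comb f \<oplus>\<^bsub>M\<^esub> comb g"
    if "f \<in> on J" "g \<in> on J" for f g J
    using that eM unfolding comb_def on_def by (auto intro: R.finite_support_add combination_add)
  have on_scale: "(\<lambda>i. a \<otimes> f i) \<in> on J" "comb (\<lambda>i. a \<otimes> f i) = a \<odot>\<^bsub>M\<^esub> comb f"
    if "f \<in> on J" "a \<in> carrier R" for f a J
    using that eM unfolding comb_def on_def by (auto intro: finite_support_scale combination_scale)
  have onD: "f i \<in> carrier R" if "f \<in> on J" for f i J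
    using that by (auto simp: on_def finite_supportD)
  define indep where "indep J \<longleftrightarrow> (\<forall>f \<in> on J. comb f = \<zero>\<^bsub>M\<^esub> \<longrightarrow> (\<forall>i. f i = \<zero>))" for J
  have "\<exists>J\<in>{J. indep J}. \<forall>J'\<in>{J. indep J}. J \<subseteq> J' \<longrightarrow> J' = J"
  proof (rule subset_Zorn_nonempty)
    have "indep {}" by (auto simp: indep_def on_def)
    then show "{J. indep J} \<noteq> {}" by blast
    fix \<C> assume ne: "\<C> \<noteq> {}" and ch: "subset.chain {J. indep J} \<C>"
    have "indep (\<Union>\<C>)" unfolding indep_def
    proof (intro ballI impI)
      fix f assume f: "f \<in> on (\<Union>\<C>)" "comb f = \<zero>\<^bsub>M\<^esub>"
      \<comment> \<open>A linear relation involves finitely many indices, and a finite subset of the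
        union of a chain lies in one of its members.\<close>
      have "finite {i. f i \<noteq> \<zero>}" "{i. f i \<noteq> \<zero>} \<subseteq> \<Union>\<C>" using f by (auto simp: on_def finite_support_def)
      then obtain J where J: "J \<in> \<C>" "{i. f i \<noteq> \<zero>} \<subseteq> J"
        using finite_subset_Union_chain[OF _ _ ne ch] by blast
      then have "f \<in> on J" using f by (auto simp: on_def)
      moreover have "indep J" using J ch by (auto simp: subset.chain_def)
      ultimately show "\<forall>i. f i = \<zero>" using f by (auto simp: indep_def)
    qed
    then show "\<Union>\<C> \<in> {J. indep J}" by blast
  qed
  then obtain J where J: "indep J" and max: "\<And>J'. indep J' \<Longrightarrow> J \<subseteq> J' \<Longrightarrow> J' = J" by auto
  have span: "\<exists>f \<in> on J. comb f = e n" for n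
  proof (cases "n \<in> J")
    case True
    then show ?thesis using combination_unit[of e n] eM
      by (intro bexI[of _ "\<lambda>i. if i = n then \<one> else \<zero>"]) (auto simp: on_def comb_def)
  next
    case False
    then have "\<not> indep (insert n J)" using max[of "insert n J"] by blast
    then obtain f j where f: "f \<in> on (insert n J)" "comb f = \<zero>\<^bsub>M\<^esub>" "f j \<noteq> \<zero>" by (auto simp: indep_def)
    \<comment> \<open>With coefficient zero at \<open>n\<close>, the relation would already live on
      the independent set \<open>J\<close>.\<close>
    have fn: "f n \<noteq> \<zero>"
    proof
      assume "f n = \<zero>"
      then have "f \<in> on J" using f by (auto simp: on_def)
      then show False using J f by (auto simp: indep_def)
    qed
    note fc = onD[OF f(1)]
    have iv: "inv (f n) \<in> carrier R" "inv (f n) \<otimes> f n = \<one>" using fn fc by (auto simp: field_Units)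
    define g where "g = (\<lambda>i. inv (f n) \<otimes> f i)"
    have g: "g \<in> on (insert n J)" "comb g = \<zero>\<^bsub>M\<^esub>" "g n = \<one>"
      using on_scale[OF f(1) iv(1)] f(2) iv by (auto simp: g_def)
    \<comment> \<open>The relation \<open>g\<close>, scaled to have coefficient one at
      \<open>n\<close>, is solved for \<open>e n\<close>: \<open>h\<close> is minus the rest, so
      \<open>g\<close> plus \<open>h\<close> is the unit family at \<open>n\<close>, while
      \<open>g\<close> combines to zero.\<close>
    define h where "h = (\<lambda>i. if i = n then \<zero> else \<ominus> g i)"
    note gc = onD[OF g(1)]
    have h: "h \<in> on J"
    proof -
      have "h \<in> finite_support R"
        using g(1) gc by (intro finite_supportI[of _ _ "{i. g i \<noteq> \<zero>}"])
          (simp_all add: h_def on_def finite_supportD)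
      moreover have "h i = \<zero>" if "i \<notin> J" for i
        using g(1) that by (simp add: on_def h_def)
      ultimately show ?thesis by (simp add: on_def)
    qed
    then have h': "h \<in> on (insert n J)" by (auto simp: on_def)
    have "(\<lambda>i. g i \<oplus> h i) = (\<lambda>i. if i = n then \<one> else \<zero>)"
      using gc g(3) by (auto simp: h_def fun_eq_iff R.r_neg)
    then have "e n = comb (\<lambda>i. g i \<oplus> h i)"
      using combination_unit(2)[of e n] eM by (simp add: comb_def)
    also have "\<dots> = comb h" using on_add(2)[OF g(1) h'] g(2) comb_closed[OF h] by simp
    finally show ?thesis using h by auto
  qed
  have uniq: "f = g" if fg: "f \<in> on J" "g \<in> on J" "comb f = comb g" for f g
  proof -
    have m: "\<ominus> \<one> \<in> carrier R" by simp
    note s = on_scale[OF fg(2) m]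
    have "comb (\<lambda>i. f i \<oplus> (\<ominus> \<one>) \<otimes> g i) = comb g \<oplus>\<^bsub>M\<^esub> ((\<ominus> \<one>) \<odot>\<^bsub>M\<^esub> comb g)"
      using on_add(2)[OF fg(1) s(1)] s(2) fg(3) by simp
    also have "\<dots> = \<zero>\<^bsub>M\<^esub>" using comb_closed[OF fg(2)] by (simp add: smult_l_minus M.r_neg)
    finally have "f i \<oplus> (\<ominus> \<one>) \<otimes> g i = \<zero>" for i
      using J on_add(1)[OF fg(1) s(1)] by (auto simp: indep_def)
    moreover have "(\<ominus> \<one>) \<otimes> g i = \<ominus> g i" for i
      using onD[OF fg(2), of i] R.l_minus[of \<one> "g i"] by simp
    ultimately have "f i \<ominus> g i = \<zero>" for i
      by (simp add: a_minus_def)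
    then show ?thesis using onD[OF fg(1)] onD[OF fg(2)] by (auto simp: fun_eq_iff)
  qed
  \<comment> \<open>The coordinates are picked by choice; uniqueness then forces them to be
    linear.\<close>
  define co where "co x = (SOME f. f \<in> on J \<and> comb f = x)" for x
  have co: "co x \<in> on J" "comb (co x) = x" if "x \<in> carrier M" for x
  proof -
    obtain n where "x = e n" using \<open>x \<in> carrier M\<close> unfolding e[symmetric] by blast
    then have "\<exists>f. f \<in> on J \<and> comb f = x" using span[of n] by auto
    from someI_ex[OF this] show "co x \<in> on J" "comb (co x) = x" unfolding co_def by blast+
  qed
  show thesis
  proof (rule that[of "\<lambda>i x. co x i"])
    fix x assume x: "x \<in> carrier M"
    show "(\<lambda>i. co x i) \<in> finite_support R" using co(1)[OF x] by (auto simp: on_def)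
    show "support_sum M (\<lambda>i. co x i \<odot>\<^bsub>M\<^esub> e i) = x" using co(2)[OF x] by (simp add: comb_def)
    fix i
    show "co (x \<oplus>\<^bsub>M\<^esub> y) i = co x i \<oplus> co y i" if y: "y \<in> carrier M" for y
      using uniq[OF co(1) on_add(1)[OF co(1)[OF x] co(1)[OF y]], of "x \<oplus>\<^bsub>M\<^esub> y"]
        on_add(2)[OF co(1)[OF x] co(1)[OF y]] co(2) x y by simp
    show "co (a \<odot>\<^bsub>M\<^esub> x) i = a \<otimes> co x i" if a: "a \<in> carrier R" for a
      using uniq[OF co(1) on_scale(1)[OF co(1)[OF x] a], of "a \<odot>\<^bsub>M\<^esub> x"]
        on_scale(2)[OF co(1)[OF x] a] co(2) x a by simp
  qed
qed

section \<open>Endomorphism algebras with inner derivations\<close>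

text \<open>The maps are extensional, with a fixed value off the carrier. Only then do maps agreeing
  on \<open>carrier V\<close> coincide, as the equations of an algebra require; this explains
  \<open>compose\<close> and \<open>restrict\<close> in the operations.\<close>

definition endomorphisms :: "('k, 'm) ring_scheme \<Rightarrow> ('k, 'v, 'n) module_scheme \<Rightarrow> ('v \<Rightarrow> 'v) set" where
  "endomorphisms K V = {F \<in> carrier V \<rightarrow>\<^sub>E carrier V.
     (\<forall>x \<in> carrier V. \<forall>y \<in> carrier V. F (x \<oplus>\<^bsub>V\<^esub> y) = F x \<oplus>\<^bsub>V\<^esub> F y) \<and>
     (\<forall>c \<in> carrier K. \<forall>x \<in> carrier V. F (c \<odot>\<^bsub>V\<^esub> x) = c \<odot>\<^bsub>V\<^esub> F x)}"

definition endomorphism_algebra ::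
    "('k, 'm) ring_scheme \<Rightarrow> ('k, 'v, 'n) module_scheme \<Rightarrow> ('d \<Rightarrow> 'v \<Rightarrow> 'v) \<Rightarrow> ('k, 'v \<Rightarrow> 'v, 'd) diff_algebra" where
  "endomorphism_algebra K V T =
     \<lparr>carrier = endomorphisms K V,
      monoid.mult = compose (carrier V), one = restrict id (carrier V),
      zero = \<lambda>x\<in>carrier V. \<zero>\<^bsub>V\<^esub>, add = \<lambda>F G. \<lambda>x\<in>carrier V. F x \<oplus>\<^bsub>V\<^esub> G x,
      smult = \<lambda>c F. \<lambda>x\<in>carrier V. c \<odot>\<^bsub>V\<^esub> F x,
      der = \<lambda>d F. \<lambda>x\<in>carrier V. T d (F x) \<ominus>\<^bsub>V\<^esub> F (T d x)\<rparr>"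

lemma endomorphismsI:
  assumes "\<And>x. x \<in> carrier V \<Longrightarrow> F x \<in> carrier V"
    and "\<And>x y. x \<in> carrier V \<Longrightarrow> y \<in> carrier V \<Longrightarrow> x \<oplus>\<^bsub>V\<^esub> y \<in> carrier V \<Longrightarrow> F (x \<oplus>\<^bsub>V\<^esub> y) = F x \<oplus>\<^bsub>V\<^esub> F y"
    and "\<And>c x. c \<in> carrier K \<Longrightarrow> x \<in> carrier V \<Longrightarrow> c \<odot>\<^bsub>V\<^esub> x \<in> carrier V \<Longrightarrow> F (c \<odot>\<^bsub>V\<^esub> x) = c \<odot>\<^bsub>V\<^esub> F x"
    and "module K V"
  shows "restrict F (carrier V) \<in> endomorphisms K V"
proof -
  interpret module K V by fact
  show ?thesis using assms by (auto simp: endomorphisms_def)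
qed

lemma endomorphismsD:
  assumes "F \<in> endomorphisms K V"
  shows "x \<in> carrier V \<Longrightarrow> F x \<in> carrier V"
    and "x \<in> carrier V \<Longrightarrow> y \<in> carrier V \<Longrightarrow> F (x \<oplus>\<^bsub>V\<^esub> y) = F x \<oplus>\<^bsub>V\<^esub> F y"
    and "c \<in> carrier K \<Longrightarrow> x \<in> carrier V \<Longrightarrow> F (c \<odot>\<^bsub>V\<^esub> x) = c \<odot>\<^bsub>V\<^esub> F x"
    and "F \<in> extensional (carrier V)"
  using assms by (auto simp: endomorphisms_def PiE_def)

lemma endomorphisms_eqI:
  assumes "F \<in> endomorphisms K V" "G \<in> endomorphisms K V" "\<And>x. x \<in> carrier V \<Longrightarrow> F x = G x"
  shows "F = G"
  using assms by (auto intro!: extensionalityI[of _ "carrier V"] dest: endomorphismsD(4))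

context module
begin

lemma endomorphism_zero:
  assumes "F \<in> endomorphisms R M" shows "F \<zero>\<^bsub>M\<^esub> = \<zero>\<^bsub>M\<^esub>"
  using endomorphismsD(3)[OF assms, of \<zero> "\<zero>\<^bsub>M\<^esub>"] endomorphismsD(1)[OF assms, of "\<zero>\<^bsub>M\<^esub>"] by simp

lemma endomorphism_minus:
  assumes F: "F \<in> endomorphisms R M" and x: "x \<in> carrier M" and y: "y \<in> carrier M"
  shows "F (x \<ominus>\<^bsub>M\<^esub> y) = F x \<ominus>\<^bsub>M\<^esub> F y"
proof -
  have "F (x \<oplus>\<^bsub>M\<^esub> (\<ominus> \<one>) \<odot>\<^bsub>M\<^esub> y) = F x \<oplus>\<^bsub>M\<^esub> (\<ominus> \<one>) \<odot>\<^bsub>M\<^esub> F y"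
    using x y by (simp add: endomorphismsD[OF F])
  then show ?thesis using x y endomorphismsD(1)[OF F] by (simp add: smult_l_minus a_minus_def)
qed

text \<open>The commutator with a fixed linear map is always a derivation. By extensionality every
  law reduces to an evaluation at vectors of the carrier.\<close>

lemma endomorphism_algebra_is_algebra:
  assumes "field R" and T: "\<And>d. d \<in> \<D> \<Longrightarrow> T d \<in> endomorphisms R M"
  shows "differential_algebra R \<D> (endomorphism_algebra R M T)" (is "differential_algebra _ _ ?E")
proof -
  have mod: "module R M" by (rule module_axioms)
  have carr: "carrier ?E = endomorphisms R M" by (simp add: endomorphism_algebra_def)
  have app: "(F \<oplus>\<^bsub>?E\<^esub> G) x = F x \<oplus>\<^bsub>M\<^esub> G x" "(F \<otimes>\<^bsub>?E\<^esub> G) x = F (G x)" "(c \<odot>\<^bsub>?E\<^esub> F) x = c \<odot>\<^bsub>M\<^esub> F x"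
    "\<zero>\<^bsub>?E\<^esub> x = \<zero>\<^bsub>M\<^esub>" "\<one>\<^bsub>?E\<^esub> x = x" "der ?E d F x = T d (F x) \<ominus>\<^bsub>M\<^esub> F (T d x)"
    if "x \<in> carrier M" for F G x c d
    using that by (simp_all add: endomorphism_algebra_def compose_def)
  have cl: "F \<oplus>\<^bsub>?E\<^esub> G \<in> carrier ?E" "F \<otimes>\<^bsub>?E\<^esub> G \<in> carrier ?E"
    if "F \<in> carrier ?E" "G \<in> carrier ?E" for F G
  proof -
    note F = endomorphismsD[OF that(1)[unfolded carr]] and G = endomorphismsD[OF that(2)[unfolded carr]]
    have "(\<lambda>x\<in>carrier M. F x \<oplus>\<^bsub>M\<^esub> G x) \<in> endomorphisms R M"
      by (rule endomorphismsI[OF _ _ _ mod]) (simp_all add: F G smult_r_distr M.a_ac)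
    moreover have "(\<lambda>x\<in>carrier M. F (G x)) \<in> endomorphisms R M"
      by (rule endomorphismsI[OF _ _ _ mod]) (simp_all add: F G)
    ultimately show "F \<oplus>\<^bsub>?E\<^esub> G \<in> carrier ?E" "F \<otimes>\<^bsub>?E\<^esub> G \<in> carrier ?E"
      by (simp_all add: endomorphism_algebra_def compose_def)
  qed
  have cz: "\<zero>\<^bsub>?E\<^esub> \<in> carrier ?E" "\<one>\<^bsub>?E\<^esub> \<in> carrier ?E"
    using endomorphismsI[OF _ _ _ mod, of "\<lambda>_. \<zero>\<^bsub>M\<^esub>"] endomorphismsI[OF _ _ _ mod, of id]
    by (simp_all add: endomorphism_algebra_def)
  have cs: "c \<odot>\<^bsub>?E\<^esub> F \<in> carrier ?E" if "c \<in> carrier R" "F \<in> carrier ?E" for c F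
  proof -
    note F = endomorphismsD[OF that(2)[unfolded carr]]
    have "(\<lambda>x\<in>carrier M. c \<odot>\<^bsub>M\<^esub> F x) \<in> endomorphisms R M"
      by (rule endomorphismsI[OF _ _ _ mod])
        (simp_all add: F that(1) smult_r_distr smult_assoc1[symmetric] R.m_comm)
    then show ?thesis by (simp add: endomorphism_algebra_def)
  qed
  have cd: "der ?E d F \<in> carrier ?E" if "d \<in> \<D>" "F \<in> carrier ?E" for d F
  proof -
    note F = endomorphismsD[OF that(2)[unfolded carr]] and Td = endomorphismsD[OF T[OF that(1)]]
    have "(\<lambda>x\<in>carrier M. T d (F x) \<ominus>\<^bsub>M\<^esub> F (T d x)) \<in> endomorphisms R M"
      by (rule endomorphismsI[OF _ _ _ mod])
        (simp_all add: F Td a_minus_def smult_r_distr smult_r_minus M.minus_add M.a_ac)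
    then show ?thesis by (simp add: endomorphism_algebra_def)
  qed
  have ext: "F = G" if "F \<in> carrier ?E" "G \<in> carrier ?E" "\<And>x. x \<in> carrier M \<Longrightarrow> F x = G x" for F G
    using endomorphisms_eqI[of F R M G] that unfolding carr by blast
  show ?thesis
  proof (rule differential_algebraI)
    fix F assume "F \<in> carrier ?E"
    note F = this and FD = endomorphismsD[OF this[unfolded carr]]
    show "\<exists>G\<in>carrier ?E. G \<oplus>\<^bsub>?E\<^esub> F = \<zero>\<^bsub>?E\<^esub>"
    proof
      show N: "(\<ominus> \<one>) \<odot>\<^bsub>?E\<^esub> F \<in> carrier ?E" using F by (intro cs) auto
      show "(\<ominus> \<one>) \<odot>\<^bsub>?E\<^esub> F \<oplus>\<^bsub>?E\<^esub> F = \<zero>\<^bsub>?E\<^esub>"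
        by (rule ext[OF cl(1)[OF N F] cz(1)]) (simp add: app FD smult_l_minus M.l_neg)
    qed
    show "\<zero>\<^bsub>?E\<^esub> \<oplus>\<^bsub>?E\<^esub> F = F" "\<one>\<^bsub>?E\<^esub> \<otimes>\<^bsub>?E\<^esub> F = F" "F \<otimes>\<^bsub>?E\<^esub> \<one>\<^bsub>?E\<^esub> = F" "\<one> \<odot>\<^bsub>?E\<^esub> F = F"
      by (rule ext; simp add: app FD cl cz cs F)+
    fix c assume c: "c \<in> carrier R"
    show "(c \<oplus> b) \<odot>\<^bsub>?E\<^esub> F = c \<odot>\<^bsub>?E\<^esub> F \<oplus>\<^bsub>?E\<^esub> b \<odot>\<^bsub>?E\<^esub> F" "(c \<otimes> b) \<odot>\<^bsub>?E\<^esub> F = c \<odot>\<^bsub>?E\<^esub> (b \<odot>\<^bsub>?E\<^esub> F)"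
      if "b \<in> carrier R" for b
      by (rule ext; simp add: app FD cl cs F c that smult_l_distr smult_assoc1)+
    show "der ?E d (c \<odot>\<^bsub>?E\<^esub> F) = c \<odot>\<^bsub>?E\<^esub> der ?E d F" if d: "d \<in> \<D>" for d
      by (rule ext; simp add: app FD cs cd F c d endomorphismsD[OF T[OF d]] a_minus_def smult_r_distr smult_r_minus)
  next
    fix F G assume "F \<in> carrier ?E" "G \<in> carrier ?E"
    note F = this(1) and FD = endomorphismsD[OF this(1)[unfolded carr]]
      and G = this(2) and GD = endomorphismsD[OF this(2)[unfolded carr]]
    show "F \<oplus>\<^bsub>?E\<^esub> G = G \<oplus>\<^bsub>?E\<^esub> F"
      by (rule ext; simp add: app FD GD cl F G M.a_comm)
    fix c assume c: "c \<in> carrier R"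
    show "c \<odot>\<^bsub>?E\<^esub> (F \<oplus>\<^bsub>?E\<^esub> G) = c \<odot>\<^bsub>?E\<^esub> F \<oplus>\<^bsub>?E\<^esub> c \<odot>\<^bsub>?E\<^esub> G"
      "(c \<odot>\<^bsub>?E\<^esub> F) \<otimes>\<^bsub>?E\<^esub> G = c \<odot>\<^bsub>?E\<^esub> (F \<otimes>\<^bsub>?E\<^esub> G)"
      "F \<otimes>\<^bsub>?E\<^esub> (c \<odot>\<^bsub>?E\<^esub> G) = c \<odot>\<^bsub>?E\<^esub> (F \<otimes>\<^bsub>?E\<^esub> G)"
      by (rule ext; simp add: app FD GD cl cs F G c smult_r_distr)+
  next
    fix d F G assume d: "d \<in> \<D>" and "F \<in> carrier ?E" "G \<in> carrier ?E"
    note F = this(2) and FD = endomorphismsD[OF this(2)[unfolded carr]]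
      and G = this(3) and GD = endomorphismsD[OF this(3)[unfolded carr]]
      and TD = endomorphismsD[OF T[OF d]]
    show "der ?E d (F \<oplus>\<^bsub>?E\<^esub> G) = der ?E d F \<oplus>\<^bsub>?E\<^esub> der ?E d G"
      by (rule ext; simp add: app FD GD TD cl cd F G d a_minus_def M.minus_add M.a_ac)
    show "der ?E d (F \<otimes>\<^bsub>?E\<^esub> G) = der ?E d F \<otimes>\<^bsub>?E\<^esub> G \<oplus>\<^bsub>?E\<^esub> F \<otimes>\<^bsub>?E\<^esub> der ?E d G"
    proof (rule ext)
      fix x assume x: "x \<in> carrier M"
      \<comment> \<open>The product rule for commutators: the term in which \<open>T d\<close>
        stands between \<open>F\<close> and \<open>G\<close> is inserted twice with opposite
        signs.\<close>
      have "T d (F (G x)) \<ominus>\<^bsub>M\<^esub> F (G (T d x)) =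
        (T d (F (G x)) \<ominus>\<^bsub>M\<^esub> F (T d (G x))) \<oplus>\<^bsub>M\<^esub> (F (T d (G x)) \<ominus>\<^bsub>M\<^esub> F (G (T d x)))"
        using x by (simp add: FD GD TD a_minus_def M.a_assoc M.r_neg1)
      then show "der ?E d (F \<otimes>\<^bsub>?E\<^esub> G) x = (der ?E d F \<otimes>\<^bsub>?E\<^esub> G \<oplus>\<^bsub>?E\<^esub> F \<otimes>\<^bsub>?E\<^esub> der ?E d G) x"
        using x by (simp add: app FD GD TD endomorphism_minus[OF F[unfolded carr]])
    qed (simp_all add: cl cd F G d)
  next
    fix F G H assume "F \<in> carrier ?E" "G \<in> carrier ?E" "H \<in> carrier ?E"
    note F = this(1) and FD = endomorphismsD[OF this(1)[unfolded carr]]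
      and G = this(2) and GD = endomorphismsD[OF this(2)[unfolded carr]]
      and H = this(3) and HD = endomorphismsD[OF this(3)[unfolded carr]]
    show "F \<oplus>\<^bsub>?E\<^esub> G \<oplus>\<^bsub>?E\<^esub> H = F \<oplus>\<^bsub>?E\<^esub> (G \<oplus>\<^bsub>?E\<^esub> H)" "F \<otimes>\<^bsub>?E\<^esub> G \<otimes>\<^bsub>?E\<^esub> H = F \<otimes>\<^bsub>?E\<^esub> (G \<otimes>\<^bsub>?E\<^esub> H)"
      "(F \<oplus>\<^bsub>?E\<^esub> G) \<otimes>\<^bsub>?E\<^esub> H = F \<otimes>\<^bsub>?E\<^esub> H \<oplus>\<^bsub>?E\<^esub> G \<otimes>\<^bsub>?E\<^esub> H" "H \<otimes>\<^bsub>?E\<^esub> (F \<oplus>\<^bsub>?E\<^esub> G) = H \<otimes>\<^bsub>?E\<^esub> F \<oplus>\<^bsub>?E\<^esub> H \<otimes>\<^bsub>?E\<^esub> G"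
      by (rule ext; simp add: app FD GD HD cl F G H M.a_assoc)+
  qed (fact cl cz cs cd assms(1))+
qed

end

section \<open>Endomorphisms of a countable direct power\<close>

text \<open>The record type \<open>module\<close> extends the ring record and so has fields for
  product and unit; the locale \<open>module\<close> puts no condition on them.\<close>

definition direct_power :: "('k, 'a, 'n) module_scheme \<Rightarrow> ('k, 'i \<Rightarrow> 'a) module" where
  "direct_power M =
     \<lparr>carrier = finite_support M, monoid.mult = undefined, one = undefined,
      zero = \<lambda>_. \<zero>\<^bsub>M\<^esub>, add = \<lambda>f g i. f i \<oplus>\<^bsub>M\<^esub> g i, smult = \<lambda>c f i. c \<odot>\<^bsub>M\<^esub> f i\<rparr>"

lemma direct_power_simps [simp]:
  "carrier (direct_power M) = finite_support M"
  "\<zero>\<^bsub>direct_power M\<^esub> = (\<lambda>_. \<zero>\<^bsub>M\<^esub>)"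
  "f \<oplus>\<^bsub>direct_power M\<^esub> g = (\<lambda>i. f i \<oplus>\<^bsub>M\<^esub> g i)"
  "c \<odot>\<^bsub>direct_power M\<^esub> f = (\<lambda>i. c \<odot>\<^bsub>M\<^esub> f i)"
  by (simp_all add: direct_power_def)

context module
begin

lemma direct_power_module: "module R (direct_power M)"
proof (rule moduleI)
  show "abelian_group (direct_power M)"
  proof (rule abelian_groupI)
    fix f :: "'i \<Rightarrow> 'c" assume f: "f \<in> carrier (direct_power M)"
    have "(\<lambda>i. \<ominus>\<^bsub>M\<^esub> f i) \<in> finite_support M"
      by (rule finite_supportI[of _ _ "{i. f i \<noteq> \<zero>\<^bsub>M\<^esub>}"]) (use f in \<open>auto simp: finite_supportD\<close>)
    then show "\<exists>g\<in>carrier (direct_power M). g \<oplus>\<^bsub>direct_power M\<^esub> f = \<zero>\<^bsub>direct_power M\<^esub>"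
      using f by (intro bexI[of _ "\<lambda>i. \<ominus>\<^bsub>M\<^esub> f i"]) (auto simp: finite_supportD M.l_neg)
  qed (auto simp: finite_supportD M.a_ac fun_eq_iff intro: M.finite_support_add
      finite_supportI[of _ _ "{}"])
qed (auto simp: finite_supportD fun_eq_iff R.is_cring smult_l_distr smult_r_distr smult_assoc1
    intro: finite_support_smult)

text \<open>Negation in the direct power is given only abstractly, as a group inverse; writing it as
  scaling by minus one makes it computable in each component.\<close>

lemma direct_power_minus:
  assumes "f \<in> finite_support M" "g \<in> finite_support M"
  shows "f \<ominus>\<^bsub>direct_power M\<^esub> g = (\<lambda>i. f i \<ominus>\<^bsub>M\<^esub> g i)"
proof -
  interpret V: module R "direct_power M :: ('a, 'i \<Rightarrow> 'c) module" by (rule direct_power_module)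
  have "f \<ominus>\<^bsub>direct_power M\<^esub> g = f \<oplus>\<^bsub>direct_power M\<^esub> (\<ominus> \<one>) \<odot>\<^bsub>direct_power M\<^esub> g"
    using assms V.smult_l_minus[of \<one> g] V.smult_one[of g] by (simp add: a_minus_def)
  also have "\<dots> = (\<lambda>i. f i \<ominus>\<^bsub>M\<^esub> g i)"
    using assms by (simp add: a_minus_def smult_l_minus finite_supportD)
  finally show ?thesis .
qed

text \<open>Linearity gives \<open>F\<close> the value zero at zero, which keeps supports finite.
  Left multiplications and derivations of \<open>A\<close> both act on the direct power in this
  way.\<close>

lemma pointwise_endomorphism:
  assumes F: "\<And>x. x \<in> carrier M \<Longrightarrow> F x \<in> carrier M"
    "\<And>x y. x \<in> carrier M \<Longrightarrow> y \<in> carrier M \<Longrightarrow> F (x \<oplus>\<^bsub>M\<^esub> y) = F x \<oplus>\<^bsub>M\<^esub> F y"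
    "\<And>c x. c \<in> carrier R \<Longrightarrow> x \<in> carrier M \<Longrightarrow> F (c \<odot>\<^bsub>M\<^esub> x) = c \<odot>\<^bsub>M\<^esub> F x"
  shows "(\<lambda>f\<in>finite_support M. \<lambda>i. F (f i)) \<in> endomorphisms R (direct_power M)"
proof -
  have F0: "F \<zero>\<^bsub>M\<^esub> = \<zero>\<^bsub>M\<^esub>" using F(3)[of \<zero> "\<zero>\<^bsub>M\<^esub>"] F(1)[of "\<zero>\<^bsub>M\<^esub>"] by simp
  have "(\<lambda>i. F (f i)) \<in> finite_support M" if f: "f \<in> finite_support M" for f :: "'i \<Rightarrow> 'c"
    by (rule finite_supportI[of _ _ "{i. f i \<noteq> \<zero>\<^bsub>M\<^esub>}"])
      (use F(1) F0 finite_supportD[OF f] in auto)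
  then show ?thesis
    unfolding direct_power_simps(1)[symmetric]
    by (intro endomorphismsI direct_power_module)
      (simp_all add: F(2,3) finite_supportD(1))
qed

lemma finite_support_reindex:
  assumes "f \<in> finite_support M" "inj \<sigma>"
  shows "(\<lambda>i. f (\<sigma> i)) \<in> finite_support M"
  using assms finite_vimageI[of "{i. f i \<noteq> \<zero>\<^bsub>M\<^esub>}" \<sigma>] by (auto simp: finite_support_def vimage_def)

text \<open>
  A linear analogue of the theorem that countably many self-maps of an infinite set lie in a
  two-generated semigroup. The operator \<open>X\<close> moves coordinate \<open>i\<close> to \<open>2 * i\<close> and \<open>R = Y X\<close> moves
  it to \<open>2 * i + 1\<close>. This fixes \<open>Y\<close> on the even coordinates; as the blocks
  \<open>R X\<^sup>n R\<close>, which move \<open>i\<close> to \<open>\<tau> n i\<close>, have disjoint odd ranges, \<open>Y\<close> can be chosen on them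
  so that \<open>Y R X\<^sup>n R = g n\<close>.
\<close>

lemma two_generated_endomorphisms:
  fixes g :: "nat \<Rightarrow> (nat \<Rightarrow> 'c) \<Rightarrow> (nat \<Rightarrow> 'c)"
  defines "V \<equiv> direct_power M"
  assumes g: "\<And>n. g n \<in> endomorphisms R V"
  obtains X Y where "X \<in> endomorphisms R V" "Y \<in> endomorphisms R V"
    "\<And>S n. X \<in> S \<Longrightarrow> Y \<in> S \<Longrightarrow>
      \<forall>F\<in>S. \<forall>G\<in>S. compose (carrier V) F G \<in> S \<Longrightarrow> g n \<in> S"
proof -
  have modV: "module R V" unfolding V_def by (rule direct_power_module)
  interpret V: module R V by (rule modV)
  have V: "carrier V = finite_support M" "\<zero>\<^bsub>V\<^esub> = (\<lambda>_. \<zero>\<^bsub>M\<^esub>)"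
    "f \<oplus>\<^bsub>V\<^esub> h = (\<lambda>i. f i \<oplus>\<^bsub>M\<^esub> h i)" "c \<odot>\<^bsub>V\<^esub> f = (\<lambda>i. c \<odot>\<^bsub>M\<^esub> f i)" for f h c
    by (simp_all add: V_def)
  have gV: "f \<in> finite_support M \<Longrightarrow> g n f \<in> finite_support M"
    "f \<in> finite_support M \<Longrightarrow> h \<in> finite_support M \<Longrightarrow> g n (\<lambda>i. f i \<oplus>\<^bsub>M\<^esub> h i) = (\<lambda>i. g n f i \<oplus>\<^bsub>M\<^esub> g n h i)"
    "c \<in> carrier R \<Longrightarrow> f \<in> finite_support M \<Longrightarrow> g n (\<lambda>i. c \<odot>\<^bsub>M\<^esub> f i) = (\<lambda>i. c \<odot>\<^bsub>M\<^esub> g n f i)"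
    "g n (\<lambda>_. \<zero>\<^bsub>M\<^esub>) = (\<lambda>_. \<zero>\<^bsub>M\<^esub>)" for f h c n
    using endomorphismsD(1-3)[OF g[of n]] V.endomorphism_zero[OF g[of n]] by (simp_all add: V)
  \<comment> \<open>The path of coordinate \<open>i\<close>: the first \<open>R\<close> gives
    \<open>2 * i + 1\<close>, then come \<open>n\<close> doublings, and the last \<open>R\<close>
    doubles and adds one. A positive integer is uniquely a power of two times an odd number, so
    \<open>n\<close> and \<open>i\<close> can be recovered.\<close>
  define \<tau> :: "nat \<Rightarrow> nat \<Rightarrow> nat" where "\<tau> n i = 2 * (2 ^ n * (2 * i + 1)) + 1" for n i
  have \<tau>_inj: "inj (\<tau> n)" for n by (auto simp: inj_def \<tau>_def)
  \<comment> \<open>This bound makes the sum over all blocks finite: a vector of finite support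
    vanishes on every block of large number.\<close>
  have \<tau>_gt: "n < \<tau> n i" for n i
  proof -
    have "n < 2 ^ n" by (rule less_exp)
    also have "\<dots> \<le> \<tau> n i" by (simp add: \<tau>_def)
    finally show ?thesis .
  qed
  \<comment> \<open>Block \<open>n\<close> of \<open>f\<close> is moved back to the original
    coordinates and \<open>g n\<close> is applied. The sum \<Gamma> of these contributions over all
    \<open>n\<close> will be the action of \<open>Y\<close> on odd coordinates.\<close>
  define \<gamma> where "\<gamma> f n = g n (\<lambda>i. f (\<tau> n i))" for f n
  have pull: "(\<lambda>i. f (\<tau> n i)) \<in> finite_support M" if "f \<in> finite_support M" for f n
    by (rule finite_support_reindex[OF that \<tau>_inj])
  have \<gamma>V: "\<gamma> f n \<in> finite_support M" if "f \<in> finite_support M" for f n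
    unfolding \<gamma>_def by (rule gV(1)[OF pull[OF that]])
  have \<gamma>_fin: "\<exists>N. \<forall>n\<ge>N. \<gamma> f n = (\<lambda>_. \<zero>\<^bsub>M\<^esub>)" if f: "f \<in> finite_support M" for f
  proof -
    obtain N where N: "\<And>i. f i \<noteq> \<zero>\<^bsub>M\<^esub> \<Longrightarrow> i < N"
      using finite_supportD(2)[OF f] unfolding finite_nat_set_iff_bounded by auto
    have "f (\<tau> n i) = \<zero>\<^bsub>M\<^esub>" if "n \<ge> N" for n i
      using N[of "\<tau> n i"] \<tau>_gt[of n i] that by fastforce
    then show ?thesis unfolding \<gamma>_def by (intro exI[of _ N]) (simp add: gV(4))
  qed
  have \<gamma>_col: "(\<lambda>n. \<gamma> f n m) \<in> finite_support M" if f: "f \<in> finite_support M" for f m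
  proof -
    obtain N where "\<forall>n\<ge>N. \<gamma> f n = (\<lambda>_. \<zero>\<^bsub>M\<^esub>)" using \<gamma>_fin[OF f] by blast
    then show ?thesis
      by (intro finite_supportI[of _ _ "{..<N}"]) (auto simp: finite_supportD(1)[OF \<gamma>V[OF f]])
  qed
  define \<Gamma> where "\<Gamma> f m = support_sum M (\<lambda>n. \<gamma> f n m)" for f m
  have \<Gamma>V: "\<Gamma> f \<in> finite_support M" if f: "f \<in> finite_support M" for f
  proof -
    obtain N where N: "\<forall>n\<ge>N. \<gamma> f n = (\<lambda>_. \<zero>\<^bsub>M\<^esub>)" using \<gamma>_fin[OF f] by blast
    have "\<Gamma> f m = \<zero>\<^bsub>M\<^esub>" if "m \<notin> (\<Union>n<N. {m. \<gamma> f n m \<noteq> \<zero>\<^bsub>M\<^esub>})" for m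
    proof -
      have "\<gamma> f n m = \<zero>\<^bsub>M\<^esub>" for n using N that by (cases "n < N") auto
      then show ?thesis by (simp add: \<Gamma>_def support_sum_def)
    qed
    then show ?thesis
      by (intro finite_supportI[of _ _ "\<Union>n<N. {m. \<gamma> f n m \<noteq> \<zero>\<^bsub>M\<^esub>}"])
        (auto simp: \<Gamma>_def finite_supportD(2)[OF \<gamma>V[OF f]] intro: M.support_sum_closed[OF \<gamma>_col[OF f]])
  qed
  have \<Gamma>_add: "\<Gamma> (\<lambda>i. f i \<oplus>\<^bsub>M\<^esub> h i) m = \<Gamma> f m \<oplus>\<^bsub>M\<^esub> \<Gamma> h m"
    if "f \<in> finite_support M" "h \<in> finite_support M" for f h m
    using M.support_sum_add[OF \<gamma>_col[OF that(1), of m] \<gamma>_col[OF that(2), of m]] gV(2)[OF pull[OF that(1)] pull[OF that(2)]]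
    by (simp add: \<Gamma>_def \<gamma>_def)
  have \<Gamma>_smult: "\<Gamma> (\<lambda>i. c \<odot>\<^bsub>M\<^esub> f i) m = c \<odot>\<^bsub>M\<^esub> \<Gamma> f m"
    if "c \<in> carrier R" "f \<in> finite_support M" for f c m
    using support_sum_smult[OF that(1) \<gamma>_col[OF that(2), of m]] gV(3)[OF that(1) pull[OF that(2)]]
    by (simp add: \<Gamma>_def \<gamma>_def)
  define x where "x f m = (if even m then f (m div 2) else \<zero>\<^bsub>M\<^esub>)" for f :: "nat \<Rightarrow> 'c" and m :: nat
  define r where "r f m = (if odd m then f (m div 2) else \<zero>\<^bsub>M\<^esub>)" for f :: "nat \<Rightarrow> 'c" and m :: nat
  \<comment> \<open>The first summand moves coordinate \<open>2 * i\<close> to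
    \<open>2 * i + 1\<close>, which makes \<open>y\<close> after \<open>x\<close> equal to
    \<open>r\<close>. The second sees only odd coordinates, as all values of \<tau> are odd, so the
    two requirements on \<open>y\<close> do not interfere.\<close>
  define y where "y f = (\<lambda>m. r (\<lambda>i. f (2 * i)) m \<oplus>\<^bsub>M\<^esub> \<Gamma> f m)" for f
  have xV: "x f \<in> finite_support M" and rV: "r f \<in> finite_support M" if f: "f \<in> finite_support M" for f
  proof -
    have "i \<in> (\<lambda>i. 2 * i) ` {i. f i \<noteq> \<zero>\<^bsub>M\<^esub>}" if "x f i \<noteq> \<zero>\<^bsub>M\<^esub>" for i
      using that by (auto simp: x_def image_iff split: if_splits intro!: exI[of _ "i div 2"])
    then have "x f i = \<zero>\<^bsub>M\<^esub>" if "i \<notin> (\<lambda>i. 2 * i) ` {i. f i \<noteq> \<zero>\<^bsub>M\<^esub>}" for i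
      using that by blast
    moreover have "x f i \<in> carrier M" for i by (simp add: x_def finite_supportD[OF f])
    ultimately show "x f \<in> finite_support M"
      by (intro finite_supportI[of _ _ "(\<lambda>i. 2 * i) ` {i. f i \<noteq> \<zero>\<^bsub>M\<^esub>}"]) (simp_all add: finite_supportD[OF f])
    have "i \<in> (\<lambda>i. 2 * i + 1) ` {i. f i \<noteq> \<zero>\<^bsub>M\<^esub>}" if "r f i \<noteq> \<zero>\<^bsub>M\<^esub>" for i
      using that by (auto simp: r_def image_iff split: if_splits intro!: exI[of _ "i div 2"])
    then have "r f i = \<zero>\<^bsub>M\<^esub>" if "i \<notin> (\<lambda>i. 2 * i + 1) ` {i. f i \<noteq> \<zero>\<^bsub>M\<^esub>}" for i
      using that by blast
    moreover have "r f i \<in> carrier M" for i by (simp add: r_def finite_supportD[OF f])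
    ultimately show "r f \<in> finite_support M"
      by (intro finite_supportI[of _ _ "(\<lambda>i. 2 * i + 1) ` {i. f i \<noteq> \<zero>\<^bsub>M\<^esub>}"]) (simp_all add: finite_supportD[OF f])
  qed
  have evV: "(\<lambda>i. f (2 * i)) \<in> finite_support M" if "f \<in> finite_support M" for f :: "nat \<Rightarrow> 'c"
    by (rule finite_support_reindex[OF that]) (auto simp: inj_def)
  have yV: "y f \<in> finite_support M" if "f \<in> finite_support M" for f
    unfolding y_def by (intro M.finite_support_add rV evV \<Gamma>V that)
  define X where "X = restrict x (finite_support M)"
  define Y where "Y = restrict y (finite_support M)"
  have X: "X \<in> endomorphisms R V"
    unfolding X_def V(1)[symmetric]
    by (rule endomorphismsI[OF _ _ _ modV]) (auto simp: V xV, auto simp: x_def fun_eq_iff)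
  have r_add: "r (\<lambda>i. f i \<oplus>\<^bsub>M\<^esub> h i) m = r f m \<oplus>\<^bsub>M\<^esub> r h m" for f h m by (simp add: r_def)
  have r_smult: "r (\<lambda>i. c \<odot>\<^bsub>M\<^esub> f i) m = c \<odot>\<^bsub>M\<^esub> r f m" if "c \<in> carrier R" for c f m using that by (simp add: r_def)
  have Y: "Y \<in> endomorphisms R V"
    unfolding Y_def V(1)[symmetric]
  proof (rule endomorphismsI[OF _ _ _ modV])
    fix f h assume "f \<in> carrier V" "h \<in> carrier V"
    then have fh: "f \<in> finite_support M" "h \<in> finite_support M" by (simp_all add: V)
    note c = finite_supportD(1)[OF rV[OF evV]] finite_supportD(1)[OF \<Gamma>V]
    show "y (f \<oplus>\<^bsub>V\<^esub> h) = y f \<oplus>\<^bsub>V\<^esub> y h"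
      using fh by (auto simp: V y_def r_add \<Gamma>_add fun_eq_iff c M.a_ac)
  next
    fix a f assume a: "a \<in> carrier R" and "f \<in> carrier V"
    then have f: "f \<in> finite_support M" by (simp add: V)
    note c = finite_supportD(1)[OF rV[OF evV]] finite_supportD(1)[OF \<Gamma>V]
    show "y (a \<odot>\<^bsub>V\<^esub> f) = a \<odot>\<^bsub>V\<^esub> y f"
      using a f by (auto simp: V y_def r_smult \<Gamma>_smult fun_eq_iff c smult_r_distr)
  qed (simp add: V yV)
  have yx: "y (x f) = r f" if f: "f \<in> finite_support M" for f
  proof -
    have "\<gamma> (x f) n = (\<lambda>_. \<zero>\<^bsub>M\<^esub>)" for n
      by (simp add: \<gamma>_def x_def \<tau>_def gV(4))
    then have "\<Gamma> (x f) m = \<zero>\<^bsub>M\<^esub>" for m by (simp add: \<Gamma>_def support_sum_def)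
    moreover have "(\<lambda>i. x f (2 * i)) = f" by (simp add: x_def)
    ultimately show ?thesis using finite_supportD(1)[OF rV[OF f]] by (simp add: y_def)
  qed
  \<comment> \<open>Disjointness of the blocks in computational form: the vector vanishes at
    positive indices whose exponent of two is not \<open>n\<close>. Each induction step strips one
    factor two; an odd index is never hit by \<open>x\<close>.\<close>
  have xr: "(x ^^ n) (r f) (2 ^ k * (2 * i + 1)) = (if k = n then f i else \<zero>\<^bsub>M\<^esub>)" for f n k i
  proof (induction n arbitrary: k)
    case 0 show ?case by (cases k) (simp_all add: r_def)
  next
    case (Suc n)
    show ?case
    proof (cases k)
      case 0 then show ?thesis by (simp add: x_def)
    next
      case (Suc l)
      have "x w (2 * m) = w m" for w m by (simp add: x_def)
      from this[of "(x ^^ n) (r f)" "2 ^ l * (2 * i + 1)"]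
      have "(x ^^ Suc n) (r f) (2 ^ k * (2 * i + 1)) = (x ^^ n) (r f) (2 ^ l * (2 * i + 1))"
        unfolding Suc by (simp only: funpow.simps comp_apply power_Suc mult.assoc)
      then show ?thesis using Suc.IH[of l] Suc by simp
    qed
  qed
  have key: "y (r ((x ^^ n) (r f))) = g n f" if f: "f \<in> finite_support M" for f n
  proof -
    \<comment> \<open>The vector \<open>r w\<close> has no even coordinates, so \<open>y\<close>
      acts on it through \<Gamma> alone, which finds \<open>f\<close> in block \<open>n\<close> and
      zero in every other block.\<close>
    define w where "w = (x ^^ n) (r f)"
    have "r w (\<tau> k i) = (if k = n then f i else \<zero>\<^bsub>M\<^esub>)" for k i
    proof -
      have "odd (\<tau> k i)" "\<tau> k i div 2 = 2 ^ k * (2 * i + 1)" by (simp_all add: \<tau>_def)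
      then have "r w (\<tau> k i) = w (2 ^ k * (2 * i + 1))" by (simp only: r_def not_False_eq_True if_True)
      then show ?thesis using xr[of n f k i] by (simp only: w_def)
    qed
    then have "\<gamma> (r w) k = (if k = n then g n f else (\<lambda>_. \<zero>\<^bsub>M\<^esub>))" for k
      by (simp add: \<gamma>_def gV(4))
    then have "\<Gamma> (r w) m = g n f m" for m
      unfolding \<Gamma>_def using finite_supportD(1)[OF gV(1)[OF f]]
      by (subst M.support_sum_single[of _ n]) auto
    moreover have "(\<lambda>i. r w (2 * i)) = (\<lambda>_. \<zero>\<^bsub>M\<^esub>)" "r (\<lambda>_. \<zero>\<^bsub>M\<^esub>) = (\<lambda>_. \<zero>\<^bsub>M\<^esub>)"
      by (simp_all add: r_def fun_eq_iff)
    ultimately show ?thesis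
      using finite_supportD(1)[OF gV(1)[OF f]] by (simp add: y_def w_def)
  qed
  show thesis
  proof (rule that[OF X Y])
    fix S n assume XS: "X \<in> S" and YS: "Y \<in> S"
      and comp: "\<forall>F\<in>S. \<forall>G\<in>S. compose (carrier V) F G \<in> S"
    \<comment> \<open>\<open>P\<close> allows plain functions to be composed: its second half keeps
      values in the carrier, where restriction changes nothing.\<close>
    define P where "P F \<longleftrightarrow> (restrict F (finite_support M) \<in> S \<and> (\<forall>h \<in> finite_support M. F h \<in> finite_support M))"
      for F :: "(nat \<Rightarrow> 'c) \<Rightarrow> (nat \<Rightarrow> 'c)"
    have PC: "P (\<lambda>f. F (G f))" if "P F" "P G" for F G
      using comp[rule_format, of "restrict F (finite_support M)" "restrict G (finite_support M)"] that
      by (auto simp: P_def compose_def V cong: restrict_cong)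
    have Px: "P x" and Py: "P y" using XS YS by (simp_all add: P_def X_def Y_def xV yV)
    have "restrict r (finite_support M) = restrict (\<lambda>f. y (x f)) (finite_support M)"
      by (rule restrict_cong) (simp_all add: yx)
    then have Pr: "P r" using PC[OF Py Px] by (simp add: P_def rV)
    have "P (\<lambda>f. (x ^^ n) (r f))"
    proof (induction n)
      case (Suc n) then show ?case using PC[OF Px Suc] by simp
    qed (simp add: Pr)
    then have "P (\<lambda>f. y (r ((x ^^ n) (r f))))" using PC[OF Py PC[OF Pr]] by blast
    moreover have "restrict (\<lambda>f. y (r ((x ^^ n) (r f)))) (finite_support M) = g n"
      using endomorphismsD(4)[OF g[of n]] by (auto simp: V key fun_eq_iff extensional_def)
    ultimately show "g n \<in> S" by (simp add: P_def)
  qed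
qed

end

text \<open>
  The operator \<open>v\<close> stores the coordinates of every \<open>f i\<close> as multiples of \<open>\<one>\<close>, spread over
  infinitely many indices; after multiplication by \<open>x\<close> they are multiples of \<open>x\<close>, and \<open>u\<close> reads
  them off by a functional that is \<open>1\<close> on \<open>x\<close>.
\<close>

lemma (in associative_algebra) exists_two_sided_inverse:
  fixes e :: "nat \<Rightarrow> 'c"
  defines "V \<equiv> direct_power M :: ('a, nat \<Rightarrow> 'c) module"
  assumes e: "range e = carrier M" and x: "x \<in> carrier M" "x \<noteq> \<zero>\<^bsub>M\<^esub>"
  obtains u v where "u \<in> endomorphisms R V" "v \<in> endomorphisms R V"
    "\<And>f. f \<in> carrier V \<Longrightarrow> u (\<lambda>i. x \<otimes>\<^bsub>M\<^esub> v f i) = f"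
proof -
  have V: "carrier V = finite_support M" "\<zero>\<^bsub>V\<^esub> = (\<lambda>_. \<zero>\<^bsub>M\<^esub>)"
    "f \<oplus>\<^bsub>V\<^esub> h = (\<lambda>i. f i \<oplus>\<^bsub>M\<^esub> h i)" "a \<odot>\<^bsub>V\<^esub> f = (\<lambda>i. a \<odot>\<^bsub>M\<^esub> f i)" for f h a
    by (simp_all add: V_def)
  have modV: "module R V" unfolding V_def by (rule direct_power_module)
  have eM [simp]: "e i \<in> carrier M" for i using e by auto
  obtain c :: "nat \<Rightarrow> 'c \<Rightarrow> 'a"
    where c_fin: "\<And>z. z \<in> carrier M \<Longrightarrow> (\<lambda>i. c i z) \<in> finite_support R"
    and c_add: "\<And>i y z. y \<in> carrier M \<Longrightarrow> z \<in> carrier M \<Longrightarrow> c i (y \<oplus>\<^bsub>M\<^esub> z) = c i y \<oplus> c i z"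
    and c_smult: "\<And>i a z. a \<in> carrier R \<Longrightarrow> z \<in> carrier M \<Longrightarrow> c i (a \<odot>\<^bsub>M\<^esub> z) = a \<otimes> c i z"
    and c_sum: "\<And>z. z \<in> carrier M \<Longrightarrow> support_sum M (\<lambda>i. c i z \<odot>\<^bsub>M\<^esub> e i) = z"
    by (rule exists_coordinates[OF R.field_axioms e]) (rule that; assumption)
  have cR [simp]: "c i z \<in> carrier R" if "z \<in> carrier M" for i z
    using finite_supportD(1)[OF c_fin[OF that]] .
  have c_zero [simp]: "c i \<zero>\<^bsub>M\<^esub> = \<zero>" for i
    using c_smult[of \<zero> "\<zero>\<^bsub>M\<^esub>" i] by simp
  obtain k where k: "c k x \<noteq> \<zero>"
  proof (rule ccontr)
    assume "\<not> thesis"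
    then have "c i x = \<zero>" for i using that by blast
    then have "support_sum M (\<lambda>i. c i x \<odot>\<^bsub>M\<^esub> e i) = \<zero>\<^bsub>M\<^esub>" by (simp add: support_sum_def)
    then show False using c_sum[OF x(1)] x(2) by simp
  qed
  \<comment> \<open>A coordinate functional that does not vanish at \<open>x\<close>, scaled to be
    one there.\<close>
  define \<mu> where "\<mu> z = inv (c k x) \<otimes> c k z" for z
  have iv [simp]: "inv (c k x) \<in> carrier R" and iv1: "inv (c k x) \<otimes> c k x = \<one>"
    using k x by (auto simp: R.field_Units)
  have \<mu>R [simp]: "\<mu> z \<in> carrier R" if "z \<in> carrier M" for z using that by (simp add: \<mu>_def)
  have \<mu>_add: "\<mu> (y \<oplus>\<^bsub>M\<^esub> z) = \<mu> y \<oplus> \<mu> z" if "y \<in> carrier M" "z \<in> carrier M" for y z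
    using that by (simp add: \<mu>_def c_add R.r_distr)
  have \<mu>_smult: "\<mu> (a \<odot>\<^bsub>M\<^esub> z) = a \<otimes> \<mu> z" if "a \<in> carrier R" "z \<in> carrier M" for a z
    using that by (simp add: \<mu>_def c_smult R.m_lcomm)
  have \<mu>_zero: "\<mu> \<zero>\<^bsub>M\<^esub> = \<zero>" by (simp add: \<mu>_def)
  have \<mu>_x: "\<mu> x = \<one>" by (simp add: \<mu>_def iv1)
  define u where "u f i = support_sum M (\<lambda>j. \<mu> (f (prod_encode (j, i))) \<odot>\<^bsub>M\<^esub> e j)" for f i
  define v where "v f m = (case prod_decode m of (j, i) \<Rightarrow> c j (f i) \<odot>\<^bsub>M\<^esub> \<one>\<^bsub>M\<^esub>)" for f m
  have row: "(\<lambda>j. \<mu> (f (prod_encode (j, i)))) \<in> finite_support R" if f: "f \<in> finite_support M" for f i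
  proof -
    have g: "(\<lambda>j. f (prod_encode (j, i))) \<in> finite_support M"
      by (rule finite_support_reindex[OF f]) (auto simp: inj_def)
    show ?thesis
      by (rule finite_supportI[of _ _ "{j. f (prod_encode (j, i)) \<noteq> \<zero>\<^bsub>M\<^esub>}"])
        (use finite_supportD[OF g] in \<open>auto simp: \<mu>_zero\<close>)
  qed
  have uV: "u f \<in> finite_support M" if f: "f \<in> finite_support M" for f
  proof (rule finite_supportI[of _ _ "(\<lambda>m. snd (prod_decode m)) ` {m. f m \<noteq> \<zero>\<^bsub>M\<^esub>}"])
    show "u f i \<in> carrier M" for i
      unfolding u_def by (intro M.support_sum_closed finite_support_combination row f eM)
    show "finite ((\<lambda>m. snd (prod_decode m)) ` {m. f m \<noteq> \<zero>\<^bsub>M\<^esub>})"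
      using finite_supportD(2)[OF f] by simp
    fix i assume i: "i \<notin> (\<lambda>m. snd (prod_decode m)) ` {m. f m \<noteq> \<zero>\<^bsub>M\<^esub>}"
    have "f (prod_encode (j, i)) = \<zero>\<^bsub>M\<^esub>" for j
    proof (rule ccontr)
      assume "f (prod_encode (j, i)) \<noteq> \<zero>\<^bsub>M\<^esub>"
      then have "snd (prod_decode (prod_encode (j, i))) \<in> (\<lambda>m. snd (prod_decode m)) ` {m. f m \<noteq> \<zero>\<^bsub>M\<^esub>}"
        by blast
      then show False using i by simp
    qed
    then show "u f i = \<zero>\<^bsub>M\<^esub>" by (simp add: u_def \<mu>_zero support_sum_def)
  qed
  have vV: "v f \<in> finite_support M" if f: "f \<in> finite_support M" for f
  proof (rule finite_supportI[of _ _ "prod_encode ` (\<Union>i\<in>{i. f i \<noteq> \<zero>\<^bsub>M\<^esub>}. (\<lambda>j. (j, i)) ` {j. c j (f i) \<noteq> \<zero>})"])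
    show "v f m \<in> carrier M" for m
      by (simp add: v_def finite_supportD(1)[OF f] split: prod.split)
    show "finite (prod_encode ` (\<Union>i\<in>{i. f i \<noteq> \<zero>\<^bsub>M\<^esub>}. (\<lambda>j. (j, i)) ` {j. c j (f i) \<noteq> \<zero>}))"
      using finite_supportD(2)[OF f] finite_supportD(2)[OF c_fin[OF finite_supportD(1)[OF f]]] by auto
    fix m assume m: "m \<notin> prod_encode ` (\<Union>i\<in>{i. f i \<noteq> \<zero>\<^bsub>M\<^esub>}. (\<lambda>j. (j, i)) ` {j. c j (f i) \<noteq> \<zero>})"
    obtain j i where ji: "prod_decode m = (j, i)" by (cases "prod_decode m")
    then have mm: "m = prod_encode (j, i)" by (metis prod_decode_inverse)
    have "c j (f i) = \<zero>"
    proof (cases "f i = \<zero>\<^bsub>M\<^esub>")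
      case False
      then show ?thesis using m unfolding mm by blast
    qed simp
    then show "v f m = \<zero>\<^bsub>M\<^esub>" by (simp add: v_def ji)
  qed
  have U: "restrict u (carrier V) \<in> endomorphisms R V"
  proof (rule endomorphismsI[OF _ _ _ modV])
    fix f h assume "f \<in> carrier V" "h \<in> carrier V"
    then have f: "f \<in> finite_support M" and h: "h \<in> finite_support M" by (simp_all add: V)
    show "u (f \<oplus>\<^bsub>V\<^esub> h) = u f \<oplus>\<^bsub>V\<^esub> u h"
    proof
      fix i
      show "u (f \<oplus>\<^bsub>V\<^esub> h) i = (u f \<oplus>\<^bsub>V\<^esub> u h) i"
        using combination_add[where e = e, OF row[OF f, of i] row[OF h, of i]]
        by (simp add: V u_def \<mu>_add finite_supportD(1)[OF f] finite_supportD(1)[OF h])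
    qed
  next
    fix a f assume a: "a \<in> carrier R" and "f \<in> carrier V"
    then have f: "f \<in> finite_support M" by (simp add: V)
    show "u (a \<odot>\<^bsub>V\<^esub> f) = a \<odot>\<^bsub>V\<^esub> u f"
    proof
      fix i
      show "u (a \<odot>\<^bsub>V\<^esub> f) i = (a \<odot>\<^bsub>V\<^esub> u f) i"
        using combination_scale[where e = e, OF a row[OF f, of i]] a
        by (simp add: V u_def \<mu>_smult finite_supportD(1)[OF f])
    qed
  qed (simp add: V uV)
  have W: "restrict v (carrier V) \<in> endomorphisms R V"
  proof (rule endomorphismsI[OF _ _ _ modV])
    fix f h assume "f \<in> carrier V" "h \<in> carrier V"
    then have f: "f \<in> finite_support M" and h: "h \<in> finite_support M" by (simp_all add: V)
    show "v (f \<oplus>\<^bsub>V\<^esub> h) = v f \<oplus>\<^bsub>V\<^esub> v h"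
      by (simp add: V v_def c_add finite_supportD(1)[OF f] finite_supportD(1)[OF h] smult_l_distr
          fun_eq_iff split: prod.split)
  next
    fix a f assume a: "a \<in> carrier R" and "f \<in> carrier V"
    then have f: "f \<in> finite_support M" by (simp add: V)
    show "v (a \<odot>\<^bsub>V\<^esub> f) = a \<odot>\<^bsub>V\<^esub> v f"
      using a by (simp add: V v_def c_smult finite_supportD(1)[OF f] smult_assoc1 fun_eq_iff split: prod.split)
  qed (simp add: V vV)
  have "u (\<lambda>m. x \<otimes>\<^bsub>M\<^esub> v f m) = f" if f: "f \<in> finite_support M" for f
  proof
    fix i
    have fi: "f i \<in> carrier M" by (rule finite_supportD(1)[OF f])
    have "\<mu> (x \<otimes>\<^bsub>M\<^esub> v f (prod_encode (j, i))) = c j (f i)" for j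
      using x fi by (simp add: v_def smult_mult_right \<mu>_smult \<mu>_x)
    then show "u (\<lambda>m. x \<otimes>\<^bsub>M\<^esub> v f m) i = f i" by (simp add: u_def c_sum[OF fi])
  qed
  moreover have "(\<lambda>m. x \<otimes>\<^bsub>M\<^esub> v f m) \<in> finite_support M" if f: "f \<in> finite_support M" for f
    by (rule finite_supportI[of _ _ "{m. v f m \<noteq> \<zero>\<^bsub>M\<^esub>}"])
      (use x finite_supportD[OF vV[OF f]] in auto)
  ultimately show thesis using that[OF U W] by (simp add: V)
qed

section \<open>The embedding theorem\<close>

theorem theorem5p3:
  fixes K :: "('k, 'm) ring_scheme"
    and \<D> :: "'d set"
    and A :: "('k, 'a, 'd) diff_algebra"
  assumes "field K" and "countable (carrier K)"
    and "countable \<D>"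
    and "differential_algebra K \<D> A"
    and "countably_generated K \<D> A"
    and "\<one>\<^bsub>A\<^esub> \<noteq> \<zero>\<^bsub>A\<^esub>"
  shows "\<exists>(B :: ('k, nat, 'd) diff_algebra) h.
           differential_algebra K \<D> B \<and>
           simple_differential_algebra \<D> B \<and>
           two_generated K \<D> B \<and>
           h \<in> differential_hom K \<D> A B \<and>
           inj_on h (carrier A)"
proof -
  interpret A: differential_algebra K \<D> A by fact
  have cA: "countable (carrier A)"
    by (rule countable_differential_algebra[OF assms(4,2,3,5)])
  let ?V = "direct_power A :: ('k, nat \<Rightarrow> 'a) module"
  have modV: "module K ?V" by (rule A.direct_power_module)
  interpret V: module K ?V by (rule modV)
  define L where "L a = (\<lambda>f\<in>finite_support A. \<lambda>i::nat. a \<otimes>\<^bsub>A\<^esub> f i)" for a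
  define T where "T d = (\<lambda>f\<in>finite_support A. \<lambda>i::nat. der A d (f i))" for d
  have L: "L a \<in> endomorphisms K ?V" if "a \<in> carrier A" for a
    unfolding L_def by (rule A.pointwise_endomorphism) (use that in \<open>simp_all add: A.M.r_distr A.smult_mult_right\<close>)
  have T: "T d \<in> endomorphisms K ?V" if "d \<in> \<D>" for d
    unfolding T_def by (rule A.pointwise_endomorphism) (use that in \<open>simp_all add: A.der_closed A.der_add A.der_smult\<close>)
  have L_app: "L a f = (\<lambda>i. a \<otimes>\<^bsub>A\<^esub> f i)" and T_app: "T d f = (\<lambda>i. der A d (f i))"
    if "f \<in> finite_support A" for a d f
    using that by (simp_all add: L_def T_def)
  have LV: "L a f \<in> finite_support A" if "a \<in> carrier A" "f \<in> finite_support A" for a f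
    using endomorphismsD(1)[OF L[OF that(1)], of f] that(2) by simp
  have TV: "T d f \<in> finite_support A" if "d \<in> \<D>" "f \<in> finite_support A" for d f
    using endomorphismsD(1)[OF T[OF that(1)], of f] that(2) by simp
  define e where "e = from_nat_into (carrier A)"
  have e: "range e = carrier A"
    unfolding e_def by (rule range_from_nat_into) (use cA A.M.one_closed in auto)
  define P where "P x u v \<longleftrightarrow> u \<in> endomorphisms K ?V \<and> v \<in> endomorphisms K ?V \<and>
    (\<forall>f \<in> finite_support A. u (L x (v f)) = f)" for x u v
  have "\<exists>u v. P x u v" if "x \<in> carrier A - {\<zero>\<^bsub>A\<^esub>}" for x
  proof -
    have x: "x \<in> carrier A" "x \<noteq> \<zero>\<^bsub>A\<^esub>" using that by auto
    obtain u v where uv: "u \<in> endomorphisms K ?V" "v \<in> endomorphisms K ?V"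
      "\<And>f. f \<in> carrier ?V \<Longrightarrow> u (\<lambda>i. x \<otimes>\<^bsub>A\<^esub> v f i) = f"
      using A.exists_two_sided_inverse[OF e x] by blast
    have "u (L x (v f)) = f" if "f \<in> finite_support A" for f
      using uv(3)[of f] endomorphismsD(1)[OF uv(2), of f] that by (simp add: L_app)
    then show ?thesis using uv(1,2) unfolding P_def by blast
  qed
  then have "\<forall>x. \<exists>u v. x \<in> carrier A - {\<zero>\<^bsub>A\<^esub>} \<longrightarrow> P x u v" by blast
  then obtain u v where P: "\<And>x. x \<in> carrier A - {\<zero>\<^bsub>A\<^esub>} \<Longrightarrow> P x (u x) (v x)"
    unfolding choice_iff by blast
  define G where "G = L ` carrier A \<union> T ` \<D> \<union> u ` (carrier A - {\<zero>\<^bsub>A\<^esub>}) \<union> v ` (carrier A - {\<zero>\<^bsub>A\<^esub>})"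
  have "countable G" unfolding G_def using cA assms(3) by auto
  moreover have "G \<noteq> {}" using A.M.one_closed unfolding G_def by blast
  ultimately have range_g: "range (from_nat_into G) = G" by (intro range_from_nat_into)
  have GE: "G \<subseteq> endomorphisms K ?V"
  proof -
    have "u x \<in> endomorphisms K ?V" "v x \<in> endomorphisms K ?V" if "x \<in> carrier A - {\<zero>\<^bsub>A\<^esub>}" for x
      using P[OF that] by (simp_all only: P_def)
    then show ?thesis unfolding G_def using L T by (intro Un_least image_subsetI)
  qed
  have gE: "from_nat_into G n \<in> endomorphisms K ?V" for n
    using GE rangeI[of "from_nat_into G" n] unfolding range_g by (rule subsetD)
  obtain X Y where XY: "X \<in> endomorphisms K ?V" "Y \<in> endomorphisms K ?V"
    and gen: "\<And>S n. X \<in> S \<Longrightarrow> Y \<in> S \<Longrightarrow>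
      \<forall>F\<in>S. \<forall>G\<in>S. compose (carrier ?V) F G \<in> S \<Longrightarrow> from_nat_into G n \<in> S"
    by (rule A.two_generated_endomorphisms[where g = "from_nat_into G", OF gE]) (rule that; assumption)
  let ?E = "endomorphism_algebra K ?V T"
  have E: "differential_algebra K \<D> ?E"
    by (rule V.endomorphism_algebra_is_algebra[OF assms(1) T])
  have carrE: "carrier ?E = endomorphisms K ?V" by (simp add: endomorphism_algebra_def)
  define C where "C = \<Inter>{S. differential_subalgebra K \<D> ?E S \<and> {X, Y} \<subseteq> S}"
  have XYE: "{X, Y} \<subseteq> carrier ?E" using XY carrE by simp
  note subC = generated_differential_subalgebra(1)[OF E XYE C_def]
  let ?C = "?E\<lparr>carrier := C\<rparr>"
  have C: "differential_algebra K \<D> ?C" by (rule differential_subalgebra_algebra[OF E subC])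
  have twoC: "two_generated K \<D> ?C"
    using generated_differential_subalgebra(2)[OF E XYE C_def] unfolding two_generated_def by blast
  obtain S where "countable S" "{X, Y} \<subseteq> S" "differential_subalgebra K \<D> ?E S"
    using countable_differential_subalgebra[OF E assms(2,3) _ XYE] by auto
  then have cC: "countable (carrier ?C)" by (auto simp: C_def intro: countable_subset[of _ S])
  have CE: "C \<subseteq> endomorphisms K ?V"
    using subC carrE by (auto simp: differential_subalgebra_def dest: subringE(1))
  have ops: "F \<otimes>\<^bsub>?C\<^esub> G = compose (carrier ?V) F G" "\<one>\<^bsub>?C\<^esub> = restrict id (carrier ?V)"
    "\<zero>\<^bsub>?C\<^esub> = (\<lambda>f\<in>carrier ?V. \<zero>\<^bsub>?V\<^esub>)" "F \<oplus>\<^bsub>?C\<^esub> G = (\<lambda>f\<in>carrier ?V. F f \<oplus>\<^bsub>?V\<^esub> G f)"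
    "c \<odot>\<^bsub>?C\<^esub> F = (\<lambda>f\<in>carrier ?V. c \<odot>\<^bsub>?V\<^esub> F f)"
    "der ?C d F = (\<lambda>f\<in>carrier ?V. T d (F f) \<ominus>\<^bsub>?V\<^esub> F (T d f))" for F G c d
    by (simp_all add: endomorphism_algebra_def)
  have compC: "compose (carrier ?V) F G \<in> C" if "F \<in> C" "G \<in> C" for F G
    using monoid.m_closed[of ?C F G] C that ops(1)
    by (simp add: differential_algebra_def associative_algebra_def ring_def)
  have XC: "X \<in> C" "Y \<in> C" by (auto simp: C_def)
  have GC: "F \<in> C" if "F \<in> G" for F

  proof -
    have "F \<in> range (from_nat_into G)" using that by (simp only: range_g)
    then obtain n where "F = from_nat_into G n" by (rule rangeE)
    then show ?thesis using gen[OF XC, of n] compC by blast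
  qed
  have LC: "L a \<in> carrier ?C" if "a \<in> carrier A" for a using GC[of "L a"] that by (simp add: G_def)
  have uvC: "u a \<in> carrier ?C" "v a \<in> carrier ?C" if "a \<in> carrier A - {\<zero>\<^bsub>A\<^esub>}" for a
    using GC[of "u a"] GC[of "v a"] that by (simp_all add: G_def)
  have ne: "\<one>\<^bsub>?C\<^esub> \<noteq> \<zero>\<^bsub>?C\<^esub>"
  proof
    assume *: "\<one>\<^bsub>?C\<^esub> = \<zero>\<^bsub>?C\<^esub>"
    let ?f = "\<lambda>i::nat. if i = 0 then \<one>\<^bsub>A\<^esub> else \<zero>\<^bsub>A\<^esub>"
    have "?f \<in> finite_support A" by (rule finite_supportI[of _ _ "{0}"]) auto
    then have "?f = (\<lambda>_. \<zero>\<^bsub>A\<^esub>)" using fun_cong[OF *[unfolded ops], of ?f] by simp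
    from fun_cong[OF this, of 0] show False using assms(6) by simp
  qed
  obtain B :: "('k, nat, 'd) diff_algebra" and \<phi> where B: "differential_algebra K \<D> B"
    "simple_differential_algebra \<D> B" "two_generated K \<D> B"
    and \<phi>: "\<phi> \<in> differential_hom K \<D> ?C B"
    and \<phi>_nz: "\<And>u x v. u \<in> carrier ?C \<Longrightarrow> x \<in> carrier ?C \<Longrightarrow> v \<in> carrier ?C \<Longrightarrow>
       u \<otimes>\<^bsub>?C\<^esub> x \<otimes>\<^bsub>?C\<^esub> v = \<one>\<^bsub>?C\<^esub> \<Longrightarrow> \<phi> x \<noteq> \<zero>\<^bsub>B\<^esub>"
    by (rule exists_simple_quotient[OF C ne cC twoC]) (rule that; assumption)
  interpret B: differential_algebra K \<D> B by fact
  have ext: "F = H" if "F \<in> endomorphisms K ?V" "H \<in> extensional (carrier ?V)" "\<And>f. f \<in> finite_support A \<Longrightarrow> F f = H f" for F H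
    using that endomorphismsD(4)[OF that(1)] by (intro extensionalityI[of _ "carrier ?V"]) auto
  have fA: "f i \<in> carrier A" if "f \<in> finite_support A" for f :: "nat \<Rightarrow> 'a" and i
    by (rule finite_supportD(1)[OF that])
  have L_mult: "L (a \<otimes>\<^bsub>A\<^esub> b) = L a \<otimes>\<^bsub>?C\<^esub> L b" if "a \<in> carrier A" "b \<in> carrier A" for a b
    unfolding ops
  proof (rule ext[OF L])
    fix f :: "nat \<Rightarrow> 'a" assume f: "f \<in> finite_support A"
    show "L (a \<otimes>\<^bsub>A\<^esub> b) f = compose (carrier ?V) (L a) (L b) f"
      using that f LV[OF that(2) f, unfolded L_app[OF f]]
      by (simp add: compose_def L_app fA A.M.m_assoc)
  qed (use that in \<open>simp_all add: compose_def\<close>)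
  have L_add: "L (a \<oplus>\<^bsub>A\<^esub> b) = L a \<oplus>\<^bsub>?C\<^esub> L b" if "a \<in> carrier A" "b \<in> carrier A" for a b
    unfolding ops
    by (rule ext[OF L]) (use that in \<open>simp_all add: L_app fA A.M.l_distr\<close>)
  have L_one: "L \<one>\<^bsub>A\<^esub> = \<one>\<^bsub>?C\<^esub>"
    unfolding ops by (rule ext[OF L]) (simp_all add: L_app fA)
  have L_smult: "L (c \<odot>\<^bsub>A\<^esub> a) = c \<odot>\<^bsub>?C\<^esub> L a" if "c \<in> carrier K" "a \<in> carrier A" for c a
    unfolding ops
    by (rule ext[OF L]) (use that in \<open>simp_all add: L_app fA A.smult_mult_left\<close>)
  have L_der: "L (der A d a) = der ?C d (L a)" if d: "d \<in> \<D>" and a: "a \<in> carrier A" for d a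
    unfolding ops
  proof (rule ext[OF L])
    fix f :: "nat \<Rightarrow> 'a" assume f: "f \<in> finite_support A"
    have "der A d a \<otimes>\<^bsub>A\<^esub> f i = der A d (a \<otimes>\<^bsub>A\<^esub> f i) \<ominus>\<^bsub>A\<^esub> a \<otimes>\<^bsub>A\<^esub> der A d (f i)" for i
      using d a fA[OF f, of i] A.der_closed[OF d]
      by (simp add: A.der_mult a_minus_def A.M.a_assoc A.M.r_neg)
    then show "L (der A d a) f = (\<lambda>f\<in>carrier ?V. T d (L a f) \<ominus>\<^bsub>?V\<^esub> L a (T d f)) f"
      using f by (simp add: A.direct_power_minus TV LV d a) (simp add: L_app T_app f LV TV d a
        LV[OF a f, unfolded L_app[OF f]] TV[OF d f, unfolded T_app[OF f]])
  qed (use A.der_closed d a in simp_all)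
  define h where "h a = \<phi> (L a)" for a
  have h: "h \<in> differential_hom K \<D> A B"
    using \<phi> LC unfolding differential_hom_def ring_hom_def h_def
    by (simp add: L_mult L_add L_one L_smult L_der Pi_iff del: partial_object.update_convs)
  interpret h: ring_hom_ring A B h
    by (rule ring_hom_ringI2[OF A.M.ring_axioms B.M.ring_axioms]) (use h in \<open>simp add: differential_hom_def\<close>)
  have "inj_on h (carrier A)"
  proof (rule inj_onI)
    fix a b assume ab: "a \<in> carrier A" "b \<in> carrier A" "h a = h b"
    let ?x = "a \<ominus>\<^bsub>A\<^esub> b"
    have "\<phi> (L ?x) = \<zero>\<^bsub>B\<^esub>" using ab by (simp add: h_def[symmetric] a_minus_def B.M.r_neg)
    moreover have "\<phi> (L ?x) \<noteq> \<zero>\<^bsub>B\<^esub>" if x: "?x \<in> carrier A - {\<zero>\<^bsub>A\<^esub>}"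
    proof (rule \<phi>_nz[of "u ?x" _ "v ?x"])
      have Px: "u ?x \<in> endomorphisms K ?V" "v ?x \<in> endomorphisms K ?V"
        "\<And>f. f \<in> finite_support A \<Longrightarrow> u ?x (L ?x (v ?x f)) = f"
        using P[OF x] by (auto simp: P_def)
      have vx: "v ?x f \<in> finite_support A" if "f \<in> finite_support A" for f
        using endomorphismsD(1)[OF Px(2), of f] that by simp
      show "u ?x \<otimes>\<^bsub>?C\<^esub> L ?x \<otimes>\<^bsub>?C\<^esub> v ?x = \<one>\<^bsub>?C\<^esub>"
        unfolding ops using Px(3) vx by (auto simp: compose_def fun_eq_iff restrict_def)
    qed (use x LC uvC in auto)
    ultimately have "?x = \<zero>\<^bsub>A\<^esub>" using ab by auto
    then show "a = b" using ab by simp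
  qed
  then show ?thesis using B h by blast
qed

end
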